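(* The $\mathcal{M}$-transform is a bijection from: 1. $\mathfrak{X}_{\boxplus}[\mathcal{P}]$ to itself, 2. $\mathfrak{X}_{\boxtimes}[\mathcal{P}]$ to $\mathcal{X}_{+}[\mathcal{P}]$. In particular, the $\mathcal{R}$-transform is a bijection from $\mathfrak{X}_{\boxplus}[\mathcal{P}]$ to itself and from $\mathcal{X}_{+}[\mathcal{P}]$ to $\mathfrak{X}_{\boxtimes}[\mathcal{P}]$.
   Context: $\mathcal{P}_k$ is the set of partitions of $\{1,\dots,k\}\cup\{1',\dots,k'\}$, $\mathcal{P}_0=\{\emptyset\}$, $\mathrm{id}_k=\{\{i,i'\}:1\le i\le k\}$, $\mathrm{id}_0=\emptyset$. $\mathfrak{S}_k$ acts on $\mathcal{P}_k$ by simultaneously permuting the labels $1,\dots,k$ and $1',\dots,k'$; $\mathbf{p}=[p]$ is the orbit of $p$. For $p\in\mathcal{P}_k$, $q\in\mathcal{P}_l$, $p\otimes q\in\mathcal{P}_{k+l}$ is obtained by placing $q$ to the right of $p$ (labels $i,i'$ of $q$ become $k+i,(k+i)'$); $[p]\otimes[q]=[p\otimes q]$ is well defined. Linear forms on $\bigoplus_k\mathbb{C}[\mathcal{P}_k/\mathfrak{S}_k]$ are identified with the $\mathfrak{S}_k$-invariant linear forms on $\bigoplus_k\mathbb{C}[\mathcal{P}_k]$. $\mathrm{nc}(p)$ is the number of blocks; $p\vee p'$ is the finest partition coarser than both; $d(p,p')=\frac12(\mathrm{nc}(p)+\mathrm{nc}(p'))-\mathrm{nc}(p\vee p')$; $p'\leq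 p$ in $\mathcal{P}_k$ if $d(\mathrm{id}_k,p')+d(p',p)=d(\mathrm{id}_k,p)$. The $\mathcal{M}$-transform on linear forms is $(\mathcal{M}(\phi))(p)=\sum_{p'\leq p}\phi(p')$; it is invertible, preserves invariant forms, and $\mathcal{R}=\mathcal{M}^{-1}$. $\epsilon_{\boxplus}(\mathbf{p})=\delta_{\mathbf{p}=\{\emptyset\}}$; $\epsilon_{\boxtimes}([\mathrm{id}_k])=1$ for all $k\geq0$ and $\epsilon_{\boxtimes}([p])=0$ for any other $p$. For $\boxdot\in\{\boxplus,\boxtimes\}$, $\mathfrak{X}_{\boxdot}[\mathcal{P}]$ is the set of $\boxdot$-infinitesimal characters, i.e. of $\phi\in\left(\bigoplus_k\mathbb{C}[\mathcal{P}_k/\mathfrak{S}_k]\right)^{*}$ with $\phi(\mathbf{p_1}\otimes\mathbf{p_2})=\phi(\mathbf{p_1})\epsilon_{\boxdot}(\mathbf{p_2})+\epsilon_{\boxdot}(\mathbf{p_1})\phi(\mathbf{p_2})$ for all orbits. $\mathcal{X}_{+}[\mathcal{P}]$ is the set of additive characters, i.e. of $\phi\in\left(\bigoplus_k\mathbb{C}[\mathcal{P}_k/\mathfrak{S}_k]\right)^{*}$ with $\phi(\mathbf{p_1}\otimes\mathbf{p_2})=\phi(\mathbf{p_1})+\phi(\mathbf{p_2})$ for all orbits. *)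

theory Defs
  imports Complex_Main "HOL-Library.Disjoint_Sets" "HOL-Library.Poly_Mapping"
    "HOL-Combinatorics.Permutations"
begin

section \<open>The sets of partitions\<close>

text \<open>\<open>Unprimed i\<close> and \<open>Primed i\<close> are the labels $i$ and $i'$. The type \<open>pdiag\<close> is the disjoint
  union of the sets $\mathcal{P}_k$, each partition being tagged with its $k$.\<close>

datatype 'a label = Unprimed 'a | Primed 'a

definition labels :: "nat \<Rightarrow> nat label set" where
  "labels k = Unprimed ` {1..k} \<union> Primed ` {1..k}"

typedef pdiag = "{(k, P). partition_on (labels k) P}"
  by (rule exI[of _ "(0, {})"]) (simp add: labels_def partition_on_def)

setup_lifting type_definition_pdiag

lift_definition deg :: "pdiag \<Rightarrow> nat" is fst .

lift_definition blocks :: "pdiag \<Rightarrow> nat label set set" is snd .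

lemma partition_on_blocks: "partition_on (labels (deg p)) (blocks p)"
  by transfer auto

lemma pdiag_eqI: "deg p = deg q \<Longrightarrow> blocks p = blocks q \<Longrightarrow> p = q"
  by transfer auto

lemma finite_labels: "finite (labels k)"
  by (simp add: labels_def)

lemma finite_deg: "finite {p. deg p = k}"
proof (rule inj_on_finite)
  show "inj_on blocks {p. deg p = k}"
    by (auto intro!: inj_onI pdiag_eqI)
  show "blocks ` {p. deg p = k} \<subseteq> {P. partition_on (labels k) P}"
    using partition_on_blocks by auto
qed (rule finitely_many_partition_on[OF finite_labels])

lift_definition id_diag :: "nat \<Rightarrow> pdiag" is
  "\<lambda>k. (k, {{Unprimed i, Primed i} | i. i \<in> {1..k}})"
  by (auto simp: partition_on_def labels_def disjoint_def) blast+

lemma deg_id_diag: "deg (id_diag k) = k"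
  by transfer simp

lemma blocks_id_diag: "blocks (id_diag k) = {{Unprimed i, Primed i} | i. i \<in> {1..k}}"
  by transfer simp

lemma deg_0_iff: "deg p = 0 \<longleftrightarrow> p = id_diag 0"
  using partition_on_blocks[of p]
  by (auto simp: deg_id_diag blocks_id_diag labels_def partition_on_empty intro!: pdiag_eqI)

section \<open>The action of the symmetric groups and the tensor product\<close>

lemma partition_on_image:
  assumes "partition_on A P" "inj_on f A"
  shows "partition_on (f ` A) ((`) f ` P)"
proof -
  have "{} \<notin> (`) f ` P"
    using partition_onD3[OF assms(1)] by auto
  then show ?thesis
    using partition_on_inj_image[OF assms] by simp
qed

text \<open>Only meaningful for \<open>\<sigma> permutes {1..deg p}\<close>.\<close>

definition act :: "(nat \<Rightarrow> nat) \<Rightarrow> pdiag \<Rightarrow> pdiag" where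
  "act \<sigma> p = Abs_pdiag (deg p, (`) (map_label \<sigma>) ` blocks p)"

lemma
  assumes "\<sigma> permutes {1..deg p}"
  shows deg_act: "deg (act \<sigma> p) = deg p"
    and blocks_act: "blocks (act \<sigma> p) = (`) (map_label \<sigma>) ` blocks p"
proof -
  have "inj (map_label \<sigma>)"
    using permutes_inj[OF assms] by (rule label.inj_map)
  then have inj: "inj_on (map_label \<sigma>) (labels (deg p))"
    by (rule inj_on_subset) simp
  have "map_label \<sigma> ` labels (deg p)
      = Unprimed ` \<sigma> ` {1..deg p} \<union> Primed ` \<sigma> ` {1..deg p}"
    by (simp only: labels_def image_Un image_image label.map)
  then have "map_label \<sigma> ` labels (deg p) = labels (deg p)"
    by (simp only: permutes_image[OF assms] labels_def)
  then have "partition_on (labels (deg p)) ((`) (map_label \<sigma>) ` blocks p)"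
    using partition_on_image[OF partition_on_blocks inj] by simp
  then show "deg (act \<sigma> p) = deg p" "blocks (act \<sigma> p) = (`) (map_label \<sigma>) ` blocks p"
    by (simp_all add: act_def deg.rep_eq blocks.rep_eq Abs_pdiag_inverse)
qed

lift_definition tensor :: "pdiag \<Rightarrow> pdiag \<Rightarrow> pdiag" (infixr "\<otimes>\<^sub>P" 70) is
  "\<lambda>(k, P) (l, Q). (k + l, P \<union> (`) (map_label ((+) k)) ` Q)"
proof clarsimp
  fix k l :: nat and P Q
  assume P: "partition_on (labels k) P" and Q: "partition_on (labels l) Q"
  let ?f = "map_label ((+) k)"
  have "inj ?f" by (intro label.inj_map) simp
  then have "inj_on ?f (labels l)" by (rule inj_on_subset) simp
  then have Q': "partition_on (?f ` labels l) ((`) ?f ` Q)"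
    by (rule partition_on_image[OF Q])
  have img: "?f ` labels l = Unprimed ` (+) k ` {1..l} \<union> Primed ` (+) k ` {1..l}"
    by (simp only: labels_def image_Un image_image label.map)
  have sh: "(+) k ` {1..l} = {k+1..k+l}"
    by simp
  have un: "labels k \<union> ?f ` labels l = labels (k + l)"
    unfolding img sh unfolding labels_def by (auto simp: image_iff)
  have dj: "labels k \<inter> ?f ` labels l = {}"
    unfolding img sh unfolding labels_def by auto
  show "partition_on (labels (k + l)) (P \<union> (`) ?f ` Q)"
  proof (rule partition_onI)
    show "\<Union> (P \<union> (`) ?f ` Q) = labels (k + l)"
      using partition_onD1[OF P] partition_onD1[OF Q'] un by simp
    show "{} \<notin> P \<union> (`) ?f ` Q"
      using partition_onD3[OF P] partition_onD3[OF Q'] by simp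
    have "disjoint (P \<union> (`) ?f ` Q)"
      using partition_onD2[OF P] partition_onD2[OF Q'] dj
      unfolding partition_onD1[OF P] partition_onD1[OF Q'] by (rule disjoint_union)
    then show "disjnt a b"
      if "a \<in> P \<union> (`) ?f ` Q" "b \<in> P \<union> (`) ?f ` Q" "a \<noteq> b" for a b
      using that by (auto dest: pairwiseD)
  qed
qed

section \<open>The geodesic order\<close>

text \<open>\<open>is_join A P Q R\<close>: the partition \<open>R\<close> of \<open>A\<close> is the finest one that is coarser than both
  \<open>P\<close> and \<open>Q\<close>.\<close>

definition is_join :: "'a set \<Rightarrow> 'a set set \<Rightarrow> 'a set set \<Rightarrow> 'a set set \<Rightarrow> bool" where
  "is_join A P Q R \<longleftrightarrow> refines A P R \<and> refines A Q R \<and>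
     (\<forall>S. refines A P S \<and> refines A Q S \<longrightarrow> refines A R S)"

definition join :: "'a set \<Rightarrow> 'a set set \<Rightarrow> 'a set set \<Rightarrow> 'a set set" where
  "join A P Q = (THE R. is_join A P Q R)"

lemma is_join_unique: "is_join A P Q R \<Longrightarrow> is_join A P Q R' \<Longrightarrow> R = R'"
  unfolding is_join_def using refines_asym by blast

lemma is_join_join:
  assumes P: "partition_on A P" and Q: "partition_on A Q"
  shows "is_join A P Q (join A P Q)"
proof -
  let ?C = "{S. refines A P S \<and> refines A Q S}"
  have "refines A P (if A = {} then {} else {A})" "refines A Q (if A = {} then {} else {A})"
    using P Q by (auto simp: refines_def partition_on_space partition_on_empty dest: partition_onD1)
  then have ne: "?C \<noteq> {}" by blast
  have part: "partition_on A S" if "S \<in> ?C" for S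
    using that by (simp add: refines_def)
  have C: "is_join A P Q (common_refinement ?C)"
    unfolding is_join_def
  proof (intro conjI allI impI)
    show "refines A P (common_refinement ?C)"
      using common_refinement_coarsest[OF part P _ ne] by blast
    show "refines A Q (common_refinement ?C)"
      using common_refinement_coarsest[OF part Q _ ne] by blast
    show "refines A (common_refinement ?C) S" if "refines A P S \<and> refines A Q S" for S
      by (rule refines_common_refinement) (use part that in auto)
  qed
  then show ?thesis
    unfolding join_def by (rule theI) (rule is_join_unique[OF _ C])
qed

definition nc :: "pdiag \<Rightarrow> nat" where
  "nc p = card (blocks p)"

text \<open>Only meaningful for \<open>deg p = deg q\<close>.\<close>

definition pdist :: "pdiag \<Rightarrow> pdiag \<Rightarrow> real" where
  "pdist p q = (real (nc p) + real (nc q)) / 2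
     - real (card (join (labels (deg p)) (blocks p) (blocks q)))"

definition geo_le :: "pdiag \<Rightarrow> pdiag \<Rightarrow> bool" (infix "\<le>\<^sub>P" 50) where
  "q \<le>\<^sub>P p \<longleftrightarrow> deg q = deg p \<and>
     pdist (id_diag (deg p)) q + pdist q p = pdist (id_diag (deg p)) p"

lemma finite_geo_le: "finite {q. q \<le>\<^sub>P p}"
  by (rule finite_subset[OF _ finite_deg[of "deg p"]]) (auto simp: geo_le_def)

section \<open>Linear forms and transforms\<close>

text \<open>The direct sum of the spaces $\mathbb{C}[\mathcal{P}_k]$ is the space of finitely supported
  functions on \<open>pdiag\<close>.\<close>

type_synonym pspace = "pdiag \<Rightarrow>\<^sub>0 complex"

abbreviation cscale :: "complex \<Rightarrow> pspace \<Rightarrow> pspace" where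
  "cscale c \<equiv> Poly_Mapping.map ((*) c)"

abbreviation basis_vec :: "pdiag \<Rightarrow> pspace" (\<open>\<langle>_\<rangle>\<close>) where
  "\<langle>p\<rangle> \<equiv> Poly_Mapping.single p 1"

lemma lookup_cscale: "Poly_Mapping.lookup (cscale c x) p = c * Poly_Mapping.lookup x p"
  by (simp add: map.rep_eq when_def)

lemma vector_space_cscale: "vector_space cscale"
  by unfold_locales
    (auto intro!: poly_mapping_eqI simp: lookup_cscale lookup_add algebra_simps)

lemma vector_space_complex: "vector_space ((*) :: complex \<Rightarrow> complex \<Rightarrow> complex)"
  by unfold_locales (auto simp: algebra_simps)

definition linear_forms :: "(pspace \<Rightarrow> complex) set" where
  "linear_forms = {\<phi>. Vector_Spaces.linear cscale (*) \<phi>}"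

text \<open>Linear forms on the direct sum of the spaces $\mathbb{C}[\mathcal{P}_k/\mathfrak{S}_k]$ are
  represented by the invariant linear forms, and their value at an orbit by the value at any
  representative of it.\<close>

definition invariant_forms :: "(pspace \<Rightarrow> complex) set" where
  "invariant_forms = {\<phi> \<in> linear_forms. \<forall>p \<sigma>. \<sigma> permutes {1..deg p} \<longrightarrow> \<phi> \<langle>act \<sigma> p\<rangle> = \<phi> \<langle>p\<rangle>}"

text \<open>The right-hand side is the linear extension of \<open>p \<mapsto> \<Sum>q | q \<le>\<^sub>P p. \<phi> \<langle>q\<rangle>\<close>.\<close>

definition M_transform :: "(pspace \<Rightarrow> complex) \<Rightarrow> (pspace \<Rightarrow> complex)" where
  "M_transform \<phi> x = (\<Sum>p \<in> Poly_Mapping.keys x. Poly_Mapping.lookup x p * (\<Sum>q | q \<le>\<^sub>P p. \<phi> \<langle>q\<rangle>))"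

lemma M_transform_basis: "M_transform \<phi> \<langle>p\<rangle> = (\<Sum>q | q \<le>\<^sub>P p. \<phi> \<langle>q\<rangle>)"
  by (simp add: M_transform_def)

lemma M_transform_linear: "M_transform \<phi> \<in> linear_forms"
proof -
  have eq: "M_transform \<phi> x = (\<Sum>p \<in> S. Poly_Mapping.lookup x p * (\<Sum>q | q \<le>\<^sub>P p. \<phi> \<langle>q\<rangle>))"
    if "finite S" "Poly_Mapping.keys x \<subseteq> S" for x S
    unfolding M_transform_def using that
    by (intro sum.mono_neutral_left) (auto simp: in_keys_iff)
  have "M_transform \<phi> (x + y) = M_transform \<phi> x + M_transform \<phi> y" for x y
    using keys_add[of x y]
    by (simp add: eq[of "Poly_Mapping.keys x \<union> Poly_Mapping.keys y"] lookup_add distrib_right sum.distrib)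
  moreover have "M_transform \<phi> (cscale c x) = c * M_transform \<phi> x" for c x
    by (subst (1 2) eq[of "Poly_Mapping.keys x"])
      (auto simp: lookup_cscale in_keys_iff sum_distrib_left mult.assoc)
  ultimately show ?thesis
    using vector_space_cscale vector_space_complex
    by (simp add: linear_forms_def Vector_Spaces.linear_def module_hom_def module_hom_axioms_def
        module_iff_vector_space)
qed

text \<open>The inverse of the bijection that \<open>M_transform\<close> induces on the space of all linear forms.\<close>

definition R_transform :: "(pspace \<Rightarrow> complex) \<Rightarrow> (pspace \<Rightarrow> complex)" where
  "R_transform = inv_into linear_forms M_transform"

section \<open>Infinitesimal and additive characters\<close>

definition eps_plus :: "pdiag \<Rightarrow> complex" where
  "eps_plus p = (if p = id_diag 0 then 1 else 0)"

definition eps_times :: "pdiag \<Rightarrow> complex" where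
  "eps_times p = (if p = id_diag (deg p) then 1 else 0)"

definition inf_chars :: "(pdiag \<Rightarrow> complex) \<Rightarrow> (pspace \<Rightarrow> complex) set" where
  "inf_chars \<epsilon> = {\<phi> \<in> invariant_forms.
     \<forall>p q. \<phi> \<langle>p \<otimes>\<^sub>P q\<rangle> = \<phi> \<langle>p\<rangle> * \<epsilon> q + \<epsilon> p * \<phi> \<langle>q\<rangle>}"

definition additive_chars :: "(pspace \<Rightarrow> complex) set" where
  "additive_chars = {\<phi> \<in> invariant_forms. \<forall>p q. \<phi> \<langle>p \<otimes>\<^sub>P q\<rangle> = \<phi> \<langle>p\<rangle> + \<phi> \<langle>q\<rangle>}"

end

theory Submission
  imports Defs
begin

text \<open>The rank function of the partition lattice is submodular. This yields the triangle
  inequality for the distance, and shows that every \<open>q \<le>\<^sub>P p\<close> refines the join of the identity with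
  \<open>p\<close>. For \<open>p = p\<^sub>1 \<otimes>\<^sub>P p\<^sub>2\<close> this join is itself a tensor product, so \<open>q\<close> splits as \<open>q\<^sub>1 \<otimes>\<^sub>P q\<^sub>2\<close>, and
  additivity of the distance gives \<open>q\<^sub>1 \<le>\<^sub>P p\<^sub>1\<close> and \<open>q\<^sub>2 \<le>\<^sub>P p\<^sub>2\<close>. Hence the transform carries the
  character equation for \<open>\<epsilon>\<close> to the one for the sum of \<open>\<epsilon>\<close> over the order, which is \<open>eps_plus\<close> for
  \<open>eps_plus\<close> and the constant 1 for \<open>eps_times\<close>. Moebius inversion gives the converse.\<close>

section \<open>Submodularity of the rank function of partitions\<close>

text \<open>For \<open>E\<close> inside \<open>A \<times> A\<close> this is connectivity in the
  graph on \<open>A\<close> with edge set \<open>E\<close>. The intersection removes the reflexive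
  pairs outside \<open>A\<close> that the closure contains.\<close>

definition eqcl :: "'a set \<Rightarrow> ('a \<times> 'a) set \<Rightarrow> ('a \<times> 'a) set" where
  "eqcl A E = (E \<union> E\<inverse>)\<^sup>* \<inter> A \<times> A"

text \<open>For finite \<open>A\<close>, the number \<open>card A - ncomp A E\<close> is the rank of
  \<open>E\<close> in the graphic matroid. Edge sets are used instead of partitions so that rank
  inequalities can be proved by adding one pair at a time.\<close>

definition ncomp :: "'a set \<Rightarrow> ('a \<times> 'a) set \<Rightarrow> nat" where
  "ncomp A E = card (A // eqcl A E)"

lemma equiv_eqcl: "equiv A (eqcl A E)"
proof (rule equivI)
  have "sym ((E \<union> E\<inverse>)\<^sup>*)" by (intro sym_rtrancl sym_Un_converse)
  then show "sym (eqcl A E)" by (auto simp: eqcl_def sym_def)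
  show "trans (eqcl A E)" by (auto simp: eqcl_def intro!: transI)
qed (auto simp: eqcl_def refl_on_def)

lemma eqcl_mono: "E \<subseteq> F \<Longrightarrow> eqcl A E \<subseteq> eqcl A F"
  unfolding eqcl_def by (intro Int_mono rtrancl_mono) auto

lemma subset_eqcl: "E \<subseteq> A \<times> A \<Longrightarrow> E \<subseteq> eqcl A E"
  unfolding eqcl_def by auto

lemma eqcl_least:
  assumes E: "E \<subseteq> r" and r: "equiv A r"
  shows "eqcl A E \<subseteq> r"
proof (rule subrelI)
  have "sym r" "trans r" "refl_on A r" using r by (auto elim: equivE)
  then have sub: "E \<union> E\<inverse> \<subseteq> r" using E symD[OF \<open>sym r\<close>] by blast
  fix x y assume "(x, y) \<in> eqcl A E"
  then have "(x, y) \<in> (E \<union> E\<inverse>)\<^sup>*" "x \<in> A" by (auto simp: eqcl_def)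
  then show "(x, y) \<in> r"
  proof (induction rule: rtrancl_induct)
    case base
    then show ?case using \<open>refl_on A r\<close> by (simp add: refl_onD)
  next
    case (step y z)
    then show ?case using sub transD[OF \<open>trans r\<close>, of x y z] by blast
  qed
qed

lemma eqcl_equiv:
  assumes "equiv A r"
  shows "eqcl A r = r"
  using eqcl_least[OF order_refl assms] subset_eqcl[OF equiv_type[OF assms]] by (rule antisym)

text \<open>The set \<open>C\<close> is saturated, that is, a union of classes, and these are merged
  into one class.\<close>

lemma equiv_Un_Times:
  assumes r: "equiv A r" and C: "C \<subseteq> A" "\<And>x y. x \<in> C \<Longrightarrow> (x, y) \<in> r \<Longrightarrow> y \<in> C"
  shows "equiv A (r \<union> C \<times> C)"
proof (rule equivI)
  have sym: "sym r" and tr: "trans r" and "refl_on A r" "r \<subseteq> A \<times> A" using r by (auto elim: equivE)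
  then show "r \<union> C \<times> C \<subseteq> A \<times> A" "refl_on A (r \<union> C \<times> C)"
    using C(1) by (auto simp: refl_on_def)
  show "sym (r \<union> C \<times> C)" by (rule sym_Un[OF sym]) (simp add: sym_def)
  have C': "x \<in> C" if "(x, y) \<in> r" "y \<in> C" for x y
    using C(2) symD[OF sym that(1)] that(2) by blast
  show "trans (r \<union> C \<times> C)"
  proof (rule transI)
    fix x y z assume "(x, y) \<in> r \<union> C \<times> C" "(y, z) \<in> r \<union> C \<times> C"
    then show "(x, z) \<in> r \<union> C \<times> C" using transD[OF tr, of x y z] C(2)[of y z] C'[of x y] by blast
  qed
qed

text \<open>A new edge glues the classes of \<open>a\<close> and \<open>b\<close> together. The
  glued relation is already an equivalence relation, and conversely any two points of the glued
  class are connected through \<open>a\<close>.\<close>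

lemma eqcl_insert:
  assumes ab: "a \<in> A" "b \<in> A" and E: "E \<subseteq> A \<times> A"
  defines "r \<equiv> eqcl A E"
  shows "eqcl A (insert (a, b) E) = r \<union> (r `` {a, b}) \<times> (r `` {a, b})"
proof
  have r: "equiv A r" by (simp add: r_def equiv_eqcl)
  then have tr: "trans r" and rA: "r \<subseteq> A \<times> A" by (auto elim: equivE)
  have "y \<in> r `` {a, b}" if "x \<in> r `` {a, b}" "(x, y) \<in> r" for x y
    using that transD[OF tr _ that(2)] by blast
  moreover have "r `` {a, b} \<subseteq> A" using rA by blast
  ultimately have eq: "equiv A (r \<union> (r `` {a, b}) \<times> (r `` {a, b}))"
    by (intro equiv_Un_Times[OF r])
  have "a \<in> r `` {a, b}" "b \<in> r `` {a, b}"
    using equiv_class_self[OF r ab(1)] equiv_class_self[OF r ab(2)] by blast+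
  then show "eqcl A (insert (a, b) E) \<subseteq> r \<union> (r `` {a, b}) \<times> (r `` {a, b})"
    using subset_eqcl[OF E] by (intro eqcl_least[OF _ eq]) (simp add: r_def le_supI1)
  let ?t = "eqcl A (insert (a, b) E)"
  have t: "sym ?t" "trans ?t" using equiv_eqcl[of A "insert (a, b) E"] by (auto elim: equivE)
  have rt: "r \<subseteq> ?t" unfolding r_def by (rule eqcl_mono) auto
  have ab_t: "(a, b) \<in> ?t" using subset_eqcl[of "insert (a, b) E" A] ab E by simp
  have a: "(a, x) \<in> ?t" if "x \<in> r `` {a, b}" for x
  proof (cases "(a, x) \<in> r")
    case False
    then have "(b, x) \<in> ?t" using that rt by blast
    then show ?thesis by (rule transD[OF t(2) ab_t])
  qed (use rt in blast)
  show "r \<union> (r `` {a, b}) \<times> (r `` {a, b}) \<subseteq> ?t"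
  proof (intro Un_least rt subrelI)
    fix x y assume "(x, y) \<in> (r `` {a, b}) \<times> (r `` {a, b})"
    then have "(a, x) \<in> ?t" "(a, y) \<in> ?t" using a by simp_all
    then show "(x, y) \<in> ?t" using transD[OF t(2)] symD[OF t(1)] by metis
  qed
qed

text \<open>An edge inside a component changes nothing; an edge between two components merges them
  and costs exactly one.\<close>

lemma ncomp_insert:
  assumes "finite A" "a \<in> A" "b \<in> A" "E \<subseteq> A \<times> A"
  shows "ncomp A E = ncomp A (insert (a, b) E) + (if (a, b) \<in> eqcl A E then 0 else 1)"
proof -
  define r where "r = eqcl A E"
  have r: "equiv A r" by (simp add: r_def equiv_eqcl)
  note ins = eqcl_insert[OF assms(2-4), folded r_def]
  have fin: "finite (A // r)" using assms(1) r by (intro finite_quotient) (auto dest: equiv_type)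
  show ?thesis
  proof (cases "(a, b) \<in> r")
    case True
    have "(r `` {a, b}) \<times> (r `` {a, b}) \<subseteq> r"
    proof -
      have "r `` {b} = r `` {a}" using True equiv_class_eq[OF r] by simp
      then have "r `` {a, b} = r `` {a}" by blast
      then show ?thesis using equiv_class_eq_iff[OF r] by auto
    qed
    then have "eqcl A (insert (a, b) E) = r" using ins by auto
    then show ?thesis using True by (simp add: ncomp_def r_def)
  next
    case False
    let ?a = "r `` {a}" and ?b = "r `` {b}"
    let ?t = "eqcl A (insert (a, b) E)"
    have ne: "?a \<noteq> ?b" using False r assms eq_equiv_class by fast
    have cls: "?t `` {x} = (if x \<in> ?a \<union> ?b then ?a \<union> ?b else r `` {x})" for x
    proof (cases "x \<in> ?a \<union> ?b")
      case True
      then have "r `` {x} = ?a \<or> r `` {x} = ?b"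
        using equiv_class_eq[OF r, of a x] equiv_class_eq[OF r, of b x] by auto
      then show ?thesis using True unfolding ins by auto
    qed (auto simp: ins)
    have aA: "a \<in> ?a" "b \<in> ?b" using assms by (simp_all only: equiv_class_self[OF r])
    have "A // ?t = insert (?a \<union> ?b) (A // r - {?a, ?b})"
    proof
      show "A // ?t \<subseteq> insert (?a \<union> ?b) (A // r - {?a, ?b})"
      proof
        fix X assume "X \<in> A // ?t"
        then obtain x where x: "x \<in> A" "X = ?t `` {x}" by (rule quotientE)
        then have "x \<in> r `` {x}" by (simp only: equiv_class_self[OF r])
        then show "X \<in> insert (?a \<union> ?b) (A // r - {?a, ?b})"
          using x cls[of x] by (auto simp: quotient_def split: if_splits)
      qed
      show "insert (?a \<union> ?b) (A // r - {?a, ?b}) \<subseteq> A // ?t"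
      proof
        fix X assume X: "X \<in> insert (?a \<union> ?b) (A // r - {?a, ?b})"
        show "X \<in> A // ?t"
        proof (cases "X = ?a \<union> ?b")
          case True
          then have "X = ?t `` {a}" using cls[of a] aA by simp
          then show ?thesis using assms by (simp add: quotientI)
        next
          case False
          then obtain x where x: "x \<in> A" "X = r `` {x}" "X \<noteq> ?a" "X \<noteq> ?b"
            using X by (auto elim!: quotientE)
          then have "x \<notin> ?a \<union> ?b" using equiv_class_eq[OF r] by blast
          then have "X = ?t `` {x}" using cls[of x] x by simp
          then show ?thesis using x by (simp add: quotientI)
        qed
      qed
    qed
    \<comment> \<open>If the union were already a class of \<open>r\<close>, then \<open>a\<close>
      and \<open>b\<close> would be related. So two classes are replaced by a genuinely new
      one.\<close>
    moreover have "?a \<union> ?b \<notin> A // r"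
    proof
      assume "?a \<union> ?b \<in> A // r"
      then show False
        using in_quotient_imp_in_rel[OF r, of "?a \<union> ?b" a b] aA False by auto
    qed
    ultimately have "card (A // ?t) = Suc (card (A // r - {?a, ?b}))"
      using fin by simp
    moreover have sub: "{?a, ?b} \<subseteq> A // r" using assms by (simp add: quotientI)
    have "card (A // r - {?a, ?b}) = card (A // r) - card {?a, ?b}"
      by (rule card_Diff_subset[OF _ sub]) simp
    moreover have "card {?a, ?b} \<le> card (A // r)" by (rule card_mono[OF fin sub])
    ultimately show ?thesis
      using False ne by (simp add: ncomp_def r_def)
  qed
qed

text \<open>Diminishing returns: the edges of \<open>F\<close> are added one by one, and an edge
  that merges two components over \<open>E' \<union> F\<close> also merges two over the smaller
  \<open>E \<union> F\<close>, so the count on the smaller side falls at least as much.\<close>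

lemma ncomp_submodular:
  assumes "finite A" "E \<subseteq> E'" "E' \<subseteq> A \<times> A" "F \<subseteq> A \<times> A"
  shows "ncomp A (E \<union> F) + ncomp A E' \<le> ncomp A E + ncomp A (E' \<union> F)"
proof -
  have "finite F" using assms by (meson finite_SigmaI finite_subset)
  then show ?thesis using assms(4)
  proof (induction F rule: finite_induct)
    case (insert e F)
    obtain a b where e: "e = (a, b)" "a \<in> A" "b \<in> A" using insert.prems by auto
    have "eqcl A (E \<union> F) \<subseteq> eqcl A (E' \<union> F)" using assms by (intro eqcl_mono) auto
    then show ?case
      using ncomp_insert[OF assms(1) e(2,3), of "E \<union> F"] ncomp_insert[OF assms(1) e(2,3), of "E' \<union> F"]
        insert e assms by (auto split: if_splits)
  qed simp
qed

lemma ncomp_antimono: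
  assumes "finite A" "E \<subseteq> A \<times> A" "F \<subseteq> A \<times> A"
  shows "ncomp A (E \<union> F) \<le> ncomp A E"
proof -
  have "finite F" using assms by (meson finite_SigmaI finite_subset)
  then show ?thesis using assms(3)
  proof (induction F rule: finite_induct)
    case (insert e F)
    obtain a b where e: "e = (a, b)" "a \<in> A" "b \<in> A" using insert.prems by auto
    show ?case
      using ncomp_insert[OF assms(1) e(2,3), of "E \<union> F"] insert e assms by auto
  qed simp
qed

text \<open>The equality case of \<open>ncomp_antimono\<close>: a pair of \<open>F\<close> outside
  the closure would by itself lower the count, and the remaining pairs cannot raise it
  again.\<close>

lemma subset_eqcl_if_ncomp_ge:
  assumes "finite A" "E \<subseteq> A \<times> A" "F \<subseteq> A \<times> A" "ncomp A E \<le> ncomp A (E \<union> F)"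
  shows "F \<subseteq> eqcl A E"
proof
  fix e assume eF: "e \<in> F"
  then obtain a b where e: "e = (a, b)" "a \<in> A" "b \<in> A" using assms by auto
  have "ncomp A (E \<union> F) \<le> ncomp A (insert e E)"
    using ncomp_antimono[of A "insert e E" F] eF assms by (auto simp: insert_absorb)
  then show "e \<in> eqcl A E"
    using ncomp_insert[OF assms(1) e(2,3), of E] assms e by (auto split: if_splits)
qed

section \<open>Joins of partitions\<close>

definition prel :: "'a set set \<Rightarrow> ('a \<times> 'a) set" where
  "prel P = {(x, y). \<exists>B\<in>P. x \<in> B \<and> y \<in> B}"

lemma equiv_prel: "partition_on A P \<Longrightarrow> equiv A (prel P)"
  unfolding prel_def by (rule equiv_partition_on)

lemma quotient_prel: "partition_on A P \<Longrightarrow> A // prel P = P"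
  unfolding prel_def by (rule partition_on_eq_quotient)

lemma prel_quotient:
  assumes r: "equiv A r"
  shows "prel (A // r) = r"
proof (intro equalityI subrelI)
  show "(x, y) \<in> r" if "(x, y) \<in> prel (A // r)" for x y
    using that in_quotient_imp_in_rel[OF r] by (auto simp: prel_def)
  show "(x, y) \<in> prel (A // r)" if "(x, y) \<in> r" for x y
  proof -
    have "x \<in> A" using that equiv_type[OF r] by auto
    then have "r `` {x} \<in> A // r" "x \<in> r `` {x}" using equiv_class_self[OF r] by (auto intro: quotientI)
    then show ?thesis using that unfolding prel_def by blast
  qed
qed

lemma prel_subset: "partition_on A P \<Longrightarrow> prel P \<subseteq> A \<times> A"
  by (rule equiv_type[OF equiv_prel])

text \<open>Refinement becomes inclusion of relations, so joins turn into generated equivalence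
  relations and block counts into component counts.\<close>

lemma refines_iff_prel_subset:
  assumes P: "partition_on A P" and Q: "partition_on A Q"
  shows "refines A P Q \<longleftrightarrow> prel P \<subseteq> prel Q"
proof
  show "prel P \<subseteq> prel Q" if "refines A P Q"
  proof (rule subrelI)
    fix x y assume "(x, y) \<in> prel P"
    then obtain X where X: "X \<in> P" "x \<in> X" "y \<in> X" by (auto simp: prel_def)
    then obtain Y where "Y \<in> Q" "X \<subseteq> Y" using \<open>refines A P Q\<close> by (auto simp: refines_def)
    then show "(x, y) \<in> prel Q" using X by (auto simp: prel_def)
  qed
  show "refines A P Q" if sub: "prel P \<subseteq> prel Q"
    unfolding refines_def
  proof (intro conjI ballI P Q)
    fix X assume X: "X \<in> P"
    then obtain x where x: "x \<in> X" using partition_onD3[OF P] by (metis ex_in_conv)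
    then have "x \<in> A" using X partition_onD1[OF P] by auto
    then have "prel Q `` {x} \<in> Q" using quotientI[of x A "prel Q"] quotient_prel[OF Q] by simp
    moreover have "X \<subseteq> prel Q `` {x}"
    proof
      fix y assume "y \<in> X"
      then have "(x, y) \<in> prel P" using x X unfolding prel_def by blast
      then show "y \<in> prel Q `` {x}" using sub by blast
    qed
    ultimately show "\<exists>Y\<in>Q. X \<subseteq> Y" by blast
  qed
qed

lemma join_eq_quotient:
  assumes P: "partition_on A P" and Q: "partition_on A Q"
  shows "join A P Q = A // eqcl A (prel P \<union> prel Q)"
proof -
  let ?r = "eqcl A (prel P \<union> prel Q)"
  have r: "equiv A ?r" by (rule equiv_eqcl)
  have part: "partition_on A (A // ?r)" by (rule partition_on_quotient[OF r])
  have sub: "prel P \<union> prel Q \<subseteq> ?r"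
    using prel_subset[OF P] prel_subset[OF Q] by (intro subset_eqcl) auto
  have "is_join A P Q (A // ?r)"
    unfolding is_join_def
  proof (intro conjI allI impI)
    show "refines A P (A // ?r)" "refines A Q (A // ?r)"
      using sub P Q part by (auto simp: refines_iff_prel_subset prel_quotient[OF r])
    fix S assume S: "refines A P S \<and> refines A Q S"
    then have pS: "partition_on A S" by (simp add: refines_def)
    have "?r \<subseteq> prel S"
      using S P Q pS by (intro eqcl_least equiv_prel) (auto simp: refines_iff_prel_subset)
    then show "refines A (A // ?r) S"
      using part pS by (simp add: refines_iff_prel_subset prel_quotient[OF r])
  qed
  then show ?thesis
    using is_join_unique is_join_join[OF P Q] by blast
qed

lemma prel_join:
  "partition_on A P \<Longrightarrow> partition_on A Q \<Longrightarrow> prel (join A P Q) = eqcl A (prel P \<union> prel Q)"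
  by (simp add: join_eq_quotient prel_quotient equiv_eqcl)

lemma card_join:
  "partition_on A P \<Longrightarrow> partition_on A Q \<Longrightarrow> card (join A P Q) = ncomp A (prel P \<union> prel Q)"
  by (simp add: join_eq_quotient ncomp_def)

lemma card_eq_ncomp: "partition_on A P \<Longrightarrow> card P = ncomp A (prel P)"
  by (simp add: ncomp_def eqcl_equiv equiv_prel quotient_prel)

section \<open>Joins under injections and disjoint unions\<close>

lemma is_joinD:
  assumes "is_join A P Q R"
  shows "refines A P R" "refines A Q R"
  using assms by (simp_all add: is_join_def)

lemma is_join_least: "is_join A P Q R \<Longrightarrow> refines A P S \<Longrightarrow> refines A Q S \<Longrightarrow> refines A R S"
  by (simp add: is_join_def)

lemma refinesD:
  assumes "refines A P R"
  shows "partition_on A P" "partition_on A R"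
  using assms by (simp_all add: refines_def)

lemma refines_image:
  assumes XY: "refines C X Y" and h: "inj_on h C"
  shows "refines (h ` C) ((`) h ` X) ((`) h ` Y)"
  unfolding refines_def
proof (intro conjI ballI)
  show "partition_on (h ` C) ((`) h ` X)" "partition_on (h ` C) ((`) h ` Y)"
    using XY h by (auto simp: refines_def intro: partition_on_image)
  fix V assume "V \<in> (`) h ` X"
  then obtain U where U: "U \<in> X" "V = h ` U" by (rule imageE)
  then obtain W where "W \<in> Y" "U \<subseteq> W" using XY by (auto simp: refines_def)
  then show "\<exists>W\<in>(`) h ` Y. V \<subseteq> W" using U by (intro bexI[of _ "h ` W"]) auto
qed

text \<open>An injection induces an isomorphism of partition lattices. A common coarsening
  \<open>S\<close> on the image is pulled back along the inverse, compared with \<open>R\<close>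
  there, and pushed forward again.\<close>

lemma is_join_image:
  assumes J: "is_join A P Q R" and f: "inj_on f A"
  shows "is_join (f ` A) ((`) f ` P) ((`) f ` Q) ((`) f ` R)"
proof -
  let ?g = "inv_into A f"
  have gf: "(`) ?g ` (`) f ` X = X" if "partition_on A X" for X
  proof -
    have "?g ` f ` B = B" if "B \<in> X" for B
      using f partition_onD1[OF \<open>partition_on A X\<close>] that by (intro inv_into_image_cancel) auto
    then have "(\<lambda>B. ?g ` f ` B) ` X = (\<lambda>B. B) ` X" by (rule image_cong[OF refl])
    then show ?thesis by (simp only: image_image[of "(`) _"] image_ident)
  qed
  have fg: "(`) f ` (`) ?g ` X = X" if "partition_on (f ` A) X" for X
  proof -
    have "f ` ?g ` B = B" if "B \<in> X" for B
      using partition_onD1[OF \<open>partition_on (f ` A) X\<close>] that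
      by (intro image_inv_into_cancel[of f A "f ` A"]) auto
    then have "(\<lambda>B. f ` ?g ` B) ` X = (\<lambda>B. B) ` X" by (rule image_cong[OF refl])
    then show ?thesis by (simp only: image_image[of "(`) _"] image_ident)
  qed
  have gA: "?g ` f ` A = A" using f by (intro inv_into_image_cancel) auto
  have parts: "partition_on A P" "partition_on A Q"
    using is_joinD[OF J] by (auto dest: refinesD)
  show ?thesis
    unfolding is_join_def
  proof (intro conjI allI impI)
    show "refines (f ` A) ((`) f ` P) ((`) f ` R)" "refines (f ` A) ((`) f ` Q) ((`) f ` R)"
      using is_joinD[OF J] f by (simp_all add: refines_image)
    fix S assume S: "refines (f ` A) ((`) f ` P) S \<and> refines (f ` A) ((`) f ` Q) S"
    then have pS: "partition_on (f ` A) S" by (simp add: refines_def)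
    have inj: "inj_on ?g (f ` A)" by (simp add: inj_on_inv_into)
    have "refines A P ((`) ?g ` S)" "refines A Q ((`) ?g ` S)"
      using refines_image[OF conjunct1[OF S] inj] refines_image[OF conjunct2[OF S] inj] by (simp_all add: gf parts gA)
    then have "refines A R ((`) ?g ` S)" by (rule is_join_least[OF J])
    from refines_image[OF this f] show "refines (f ` A) ((`) f ` R) S" by (simp add: fg pS)
  qed
qed

lemma partition_on_Un:
  assumes "partition_on A P" "partition_on B Q" "A \<inter> B = {}"
  shows "partition_on (A \<union> B) (P \<union> Q)"
  using assms disjoint_union[of P Q] by (auto simp: partition_on_def)

lemma refines_Un:
  assumes 1: "refines A P R" and 2: "refines B P' R'" and "A \<inter> B = {}"
  shows "refines (A \<union> B) (P \<union> P') (R \<union> R')"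
  unfolding refines_def
proof (intro conjI ballI)
  show "partition_on (A \<union> B) (P \<union> P')" "partition_on (A \<union> B) (R \<union> R')"
    using assms by (simp_all add: refines_def partition_on_Un)
  show "\<exists>Y\<in>R \<union> R'. X \<subseteq> Y" if "X \<in> P \<union> P'" for X
    using that
  proof
    assume "X \<in> P"
    then obtain Y where "Y \<in> R" "X \<subseteq> Y" using 1 unfolding refines_def by meson
    then show ?thesis by blast
  next
    assume "X \<in> P'"
    then obtain Y where "Y \<in> R'" "X \<subseteq> Y" using 2 unfolding refines_def by meson
    then show ?thesis by blast
  qed
qed

text \<open>The right-hand side is the trace of \<open>S\<close> on \<open>C\<close>; blocks of
  \<open>S\<close> that miss \<open>C\<close> leave an empty trace, which has to be removed.\<close>

lemma refines_restrict:
  assumes XY: "refines D (X \<union> Y) S" and X: "partition_on C X" and "C \<subseteq> D"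
  shows "refines C X ((\<inter>) C ` S - {{}})"
  unfolding refines_def
proof (intro conjI ballI X)
  have "partition_on (C \<inter> D) ((\<inter>) C ` S - {{}})"
    using XY by (intro partition_on_restrict) (simp add: refines_def)
  then show "partition_on C ((\<inter>) C ` S - {{}})"
    using \<open>C \<subseteq> D\<close> by (simp add: Int_absorb2)
  fix V assume V: "V \<in> X"
  then obtain Z where Z: "Z \<in> S" "V \<subseteq> Z" using XY unfolding refines_def by blast
  moreover have "V \<subseteq> C" "V \<noteq> {}" using V X by (auto simp: partition_on_def)
  ultimately have "V \<subseteq> C \<inter> Z" "C \<inter> Z \<noteq> {}" by auto
  then show "\<exists>Z \<in> (\<inter>) C ` S - {{}}. V \<subseteq> Z" using Z(1) by (intro bexI[of _ "C \<inter> Z"]) simp_all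
qed

text \<open>A common coarsening \<open>S\<close> may have blocks that meet both \<open>A\<close> and
  \<open>B\<close>. Its traces on the two sides are compared with \<open>R\<close> and
  \<open>R'\<close> separately, and each block of a trace lies in a block of
  \<open>S\<close>.\<close>

lemma is_join_Un:
  assumes J: "is_join A P Q R" and J': "is_join B P' Q' R'" and AB: "A \<inter> B = {}"
  shows "is_join (A \<union> B) (P \<union> P') (Q \<union> Q') (R \<union> R')"
  unfolding is_join_def
proof (intro conjI allI impI)
  have parts: "partition_on A P" "partition_on A Q" "partition_on B P'" "partition_on B Q'"
    using is_joinD[OF J] is_joinD[OF J'] by (auto dest: refinesD)
  show "refines (A \<union> B) (P \<union> P') (R \<union> R')" "refines (A \<union> B) (Q \<union> Q') (R \<union> R')"
    using is_joinD[OF J] is_joinD[OF J'] AB by (simp_all add: refines_Un)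
  fix S assume S: "refines (A \<union> B) (P \<union> P') S \<and> refines (A \<union> B) (Q \<union> Q') S"
  have "refines A P ((\<inter>) A ` S - {{}})" "refines A Q ((\<inter>) A ` S - {{}})"
    by (rule refines_restrict[OF conjunct1[OF S] parts(1) Un_upper1]
        refines_restrict[OF conjunct2[OF S] parts(2) Un_upper1])+
  then have 1: "refines A R ((\<inter>) A ` S - {{}})" by (rule is_join_least[OF J])
  have "refines B P' ((\<inter>) B ` S - {{}})" "refines B Q' ((\<inter>) B ` S - {{}})"
    using S parts refines_restrict[of "A \<union> B" P' P S B] refines_restrict[of "A \<union> B" Q' Q S B]
    by (simp_all only: Un_commute[of P'] Un_commute[of Q'] Un_upper2)
  then have 2: "refines B R' ((\<inter>) B ` S - {{}})" by (rule is_join_least[OF J'])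
  show "refines (A \<union> B) (R \<union> R') S"
    unfolding refines_def
  proof (intro conjI ballI)
    show "partition_on (A \<union> B) (R \<union> R')"
      using is_joinD[OF J] is_joinD[OF J'] AB by (meson refinesD partition_on_Un)
    show "partition_on (A \<union> B) S" using S by (simp add: refines_def)
    have sub: "\<exists>Y\<in>S. X \<subseteq> Y" if CT: "refines C T ((\<inter>) C ` S - {{}})" and "X \<in> T" for C T X
    proof -
      obtain Z where "Z \<in> (\<inter>) C ` S - {{}}" "X \<subseteq> Z" using CT \<open>X \<in> T\<close> unfolding refines_def by meson
      then show ?thesis by auto
    qed
    show "\<exists>Y\<in>S. X \<subseteq> Y" if "X \<in> R \<union> R'" for X
      using that sub[OF 1, of X] sub[OF 2, of X] by (elim UnE)
  qed
qed

lemma partition_on_split: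
  assumes Q: "partition_on (A \<union> B) Q" and AB: "A \<inter> B = {}"
    and split: "\<And>X. X \<in> Q \<Longrightarrow> X \<subseteq> A \<or> X \<subseteq> B"
  shows "partition_on A {X \<in> Q. X \<subseteq> A}"
proof (rule partition_onI)
  show "\<Union> {X \<in> Q. X \<subseteq> A} = A"
  proof (intro equalityI subsetI)
    fix x assume x: "x \<in> A"
    then obtain X where X: "X \<in> Q" "x \<in> X" using partition_onD1[OF Q] by blast
    then show "x \<in> \<Union> {X \<in> Q. X \<subseteq> A}" using split[OF X(1)] x AB by blast
  qed auto
  show "disjnt X Y" if "X \<in> {X \<in> Q. X \<subseteq> A}" "Y \<in> {X \<in> Q. X \<subseteq> A}" "X \<noteq> Y" for X Y
    using that partition_onD2[OF Q] by (auto dest: pairwiseD)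
  show "{} \<notin> {X \<in> Q. X \<subseteq> A}" using partition_onD3[OF Q] by simp
qed

lemma card_partition_on_Un:
  assumes P: "partition_on A P" and Q: "partition_on B Q" and "A \<inter> B = {}" "finite A" "finite B"
  shows "card (P \<union> Q) = card P + card Q"
proof (rule card_Un_disjoint)
  show "finite P" "finite Q" using assms finite_elements by blast+
  show "P \<inter> Q = {}"
  proof (rule ccontr)
    assume "P \<inter> Q \<noteq> {}"
    then obtain X where X: "X \<in> P" "X \<in> Q" by blast
    then have "X \<subseteq> A" "X \<subseteq> B" using partition_onD1[OF P] partition_onD1[OF Q] by blast+
    then have "X = {}" using \<open>A \<inter> B = {}\<close> by blast
    then show False using X partition_onD3[OF P] by simp
  qed
qed

lemma partition_on_cover: "partition_on A P \<Longrightarrow> X \<in> P \<Longrightarrow> X \<subseteq> A"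
  unfolding partition_on_def by blast

section \<open>The geodesic order\<close>

definition pjoin :: "pdiag \<Rightarrow> pdiag \<Rightarrow> nat label set set" where
  "pjoin p q = join (labels (deg p)) (blocks p) (blocks q)"

lemma pdist_pjoin: "pdist p q = (real (nc p) + real (nc q)) / 2 - real (card (pjoin p q))"
  by (simp add: pdist_def pjoin_def)

lemma is_join_pjoin:
  "deg p = deg q \<Longrightarrow> is_join (labels (deg q)) (blocks p) (blocks q) (pjoin p q)"
  using is_join_join[OF partition_on_blocks[of p], of "blocks q"] partition_on_blocks[of q]
  by (simp add: pjoin_def)

lemma card_pjoin:
  "deg p = deg q \<Longrightarrow> card (pjoin p q) = ncomp (labels (deg q)) (prel (blocks p) \<union> prel (blocks q))"
  using card_join[OF partition_on_blocks[of p], of "blocks q"] partition_on_blocks[of q]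
  by (simp add: pjoin_def)

lemma nc_eq_ncomp: "nc p = ncomp (labels (deg p)) (prel (blocks p))"
  unfolding nc_def by (rule card_eq_ncomp[OF partition_on_blocks])

lemma prel_blocks_subset: "prel (blocks p) \<subseteq> labels (deg p) \<times> labels (deg p)"
  by (rule prel_subset[OF partition_on_blocks])

lemma card_pjoin_le:
  assumes "deg p = deg q"
  shows "card (pjoin p q) \<le> nc p" "card (pjoin p q) \<le> nc q"
  using ncomp_antimono[OF finite_labels prel_blocks_subset[of p], of "prel (blocks q)"]
    ncomp_antimono[OF finite_labels prel_blocks_subset[of q], of "prel (blocks p)"]
    prel_blocks_subset[of p] prel_blocks_subset[of q] assms
  by (simp_all add: card_pjoin nc_eq_ncomp Un_commute)

section \<open>Metric properties of the distance on partitions of equal degree\<close>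

lemma pdist_self [simp]: "pdist p p = 0"
  by (simp add: pdist_pjoin card_pjoin nc_eq_ncomp)

lemma pdist_nonneg: "deg p = deg q \<Longrightarrow> 0 \<le> pdist p q"
  using card_pjoin_le[of p q] by (simp add: pdist_pjoin)

lemma prel_blocks_inject:
  assumes "deg p = deg q" "prel (blocks p) = prel (blocks q)"
  shows "p = q"
proof (rule pdiag_eqI)
  show "blocks p = blocks q"
    using quotient_prel[OF partition_on_blocks[of p]] by (simp only: assms quotient_prel partition_on_blocks)
qed fact

text \<open>Distance zero makes both bounds of \<open>card_pjoin_le\<close> equalities; the equality
  case \<open>subset_eqcl_if_ncomp_ge\<close> then gives inclusion of the relations in both
  directions.\<close>

lemma pdist_eq_0:
  assumes d: "deg p = deg q" and "pdist p q = 0"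
  shows "p = q"
proof -
  have c: "card (pjoin p q) = nc p" "card (pjoin p q) = nc q"
    using card_pjoin_le[OF d] assms(2) by (simp_all add: pdist_pjoin)
  have "prel (blocks q) \<subseteq> eqcl (labels (deg p)) (prel (blocks p))"
    using c d prel_blocks_subset[of p] prel_blocks_subset[of q]
    by (intro subset_eqcl_if_ncomp_ge finite_labels) (simp_all add: card_pjoin nc_eq_ncomp)
  moreover have "prel (blocks p) \<subseteq> eqcl (labels (deg q)) (prel (blocks q))"
    using c d prel_blocks_subset[of p] prel_blocks_subset[of q]
    by (intro subset_eqcl_if_ncomp_ge finite_labels) (simp_all add: card_pjoin nc_eq_ncomp Un_commute)
  moreover have "eqcl (labels (deg r)) (prel (blocks r)) = prel (blocks r)" for r
    by (intro eqcl_equiv equiv_prel partition_on_blocks)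
  ultimately show ?thesis
    by (intro prel_blocks_inject[OF d]) simp
qed

text \<open>Submodularity over \<open>q\<close>: joining with \<open>p\<close> costs no more
  components after joining with \<open>r\<close> than before. The triple join is kept because
  \<open>geo_le_refines\<close> needs this sharper form of the triangle inequality.\<close>

lemma card_pjoin_triple:
  assumes d: "deg p = deg q" "deg q = deg r"
  shows "card (pjoin p q) + card (pjoin q r)
    \<le> nc q + ncomp (labels (deg r)) (prel (blocks p) \<union> prel (blocks r) \<union> prel (blocks q))"
  using ncomp_submodular[OF finite_labels[of "deg r"], of "prel (blocks q)"
      "prel (blocks q) \<union> prel (blocks r)" "prel (blocks p)"]
    prel_blocks_subset[of p] prel_blocks_subset[of q] prel_blocks_subset[of r] d
  by (simp add: card_pjoin nc_eq_ncomp Un_ac)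

lemma pdist_triangle:
  assumes d: "deg p = deg q" "deg q = deg r"
  shows "pdist p r \<le> pdist p q + pdist q r"
proof -
  have "ncomp (labels (deg r)) (prel (blocks p) \<union> prel (blocks r) \<union> prel (blocks q))
      \<le> card (pjoin p r)"
    using ncomp_antimono[OF finite_labels[of "deg r"], of "prel (blocks p) \<union> prel (blocks r)"]
      prel_blocks_subset[of p] prel_blocks_subset[of q] prel_blocks_subset[of r] d
    by (simp add: card_pjoin)
  then show ?thesis using card_pjoin_triple[OF d] by (simp add: pdist_pjoin field_simps)
qed

lemma geo_le_deg: "q \<le>\<^sub>P p \<Longrightarrow> deg q = deg p"
  by (simp add: geo_le_def)

text \<open>Elements of a geodesic from the identity to \<open>p\<close> cannot connect different blocks of the join
  of the identity with \<open>p\<close>; this makes the order compatible with the tensor product.\<close>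

lemma geo_le_refines:
  assumes le: "q \<le>\<^sub>P p"
  shows "refines (labels (deg p)) (blocks q) (pjoin (id_diag (deg p)) p)"
proof -
  let ?i = "id_diag (deg p)" and ?L = "labels (deg p)"
  have d: "deg ?i = deg q" "deg q = deg p" using le by (simp_all add: geo_le_def deg_id_diag)
  have d': "deg ?i = deg p" by (rule deg_id_diag)
  have part: "partition_on ?L (blocks ?i)" "partition_on ?L (blocks p)" "partition_on ?L (blocks q)"
    using partition_on_blocks[of ?i] partition_on_blocks[of p] partition_on_blocks[of q] d d' by simp_all
  note sub = prel_subset[OF part(1)] prel_subset[OF part(2)] prel_subset[OF part(3)]
  have "pdist ?i q + pdist q p = pdist ?i p" using le by (simp add: geo_le_def)
  then have "real (card (pjoin ?i q)) + real (card (pjoin q p)) = real (nc q) + real (card (pjoin ?i p))"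
    by (simp add: pdist_pjoin field_simps)
  \<comment> \<open>Equality in the triangle inequality means that adding \<open>q\<close> to the
    identity and \<open>p\<close> loses no component, so the equality case of antitonicity puts
    \<open>q\<close> inside their join.\<close>
  then have "card (pjoin ?i p) \<le> ncomp ?L (prel (blocks ?i) \<union> prel (blocks p) \<union> prel (blocks q))"
    using card_pjoin_triple[OF d] by linarith
  then have "prel (blocks q) \<subseteq> eqcl ?L (prel (blocks ?i) \<union> prel (blocks p))"
    using sub d' by (intro subset_eqcl_if_ncomp_ge finite_labels) (simp_all add: card_pjoin)
  also have "\<dots> = prel (pjoin ?i p)"
    using prel_join[OF part(1,2)] d' by (simp add: pjoin_def)
  finally show ?thesis
    using refinesD(2)[OF is_joinD(1)[OF is_join_pjoin[OF d']]] part(3)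
    by (simp add: refines_iff_prel_subset)
qed

section \<open>Extremal elements of the order and a rank for well-founded induction\<close>

lemma geo_le_refl: "p \<le>\<^sub>P p"
  by (simp add: geo_le_def)

lemma id_diag_geo_le: "id_diag (deg p) \<le>\<^sub>P p"
  by (simp add: geo_le_def deg_id_diag)

text \<open>The distance to the identity is a real number; counting the partitions strictly closer
  to the identity turns it into a natural number fit for recursion.\<close>

definition geo_rank :: "pdiag \<Rightarrow> nat" where
  "geo_rank p = card {r. deg r = deg p \<and> pdist (id_diag (deg p)) r < pdist (id_diag (deg p)) p}"

text \<open>Definiteness of the distance places \<open>q\<close> strictly closer to the identity
  than \<open>p\<close>, and \<open>q\<close> itself is then counted for \<open>p\<close> but not
  for \<open>q\<close>.\<close>

lemma geo_rank_less:
  assumes "q \<le>\<^sub>P p" "q \<noteq> p"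
  shows "geo_rank q < geo_rank p"
proof -
  let ?i = "id_diag (deg p)"
  have d: "deg q = deg p" using assms by (simp add: geo_le_def)
  then have "pdist q p > 0" using assms pdist_nonneg[OF d] pdist_eq_0[OF d] by fastforce
  then have lt: "pdist ?i q < pdist ?i p" using assms by (simp add: geo_le_def)
  show ?thesis
    unfolding geo_rank_def d
  proof (rule psubset_card_mono)
    show "finite {r. deg r = deg p \<and> pdist ?i r < pdist ?i p}"
      by (rule finite_subset[OF _ finite_deg[of "deg p"]]) auto
    show "{r. deg r = deg p \<and> pdist ?i r < pdist ?i q} \<subset> {r. deg r = deg p \<and> pdist ?i r < pdist ?i p}"
      using lt d by force
  qed
qed

section \<open>Compatibility with the tensor product\<close>

abbreviation shift :: "nat \<Rightarrow> nat label \<Rightarrow> nat label" where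
  "shift k \<equiv> map_label ((+) k)"

lemma deg_tensor [simp]: "deg (p \<otimes>\<^sub>P q) = deg p + deg q"
  by transfer (auto split: prod.splits)

lemma blocks_tensor: "blocks (p \<otimes>\<^sub>P q) = blocks p \<union> (`) (shift (deg p)) ` blocks q"
  by transfer (auto split: prod.splits)

lemma inj_shift: "inj_on (shift k) A"
proof -
  have "inj (shift k)" by (rule label.inj_map) simp
  then show ?thesis by (rule inj_on_subset) simp
qed

lemma labels_add: "labels (k + l) = labels k \<union> shift k ` labels l"
  and labels_add_disjoint: "labels k \<inter> shift k ` labels l = {}"
proof -
  have img: "shift k ` labels l = Unprimed ` {k+1..k+l} \<union> Primed ` {k+1..k+l}"
  proof -
    have "shift k ` labels l = Unprimed ` (+) k ` {1..l} \<union> Primed ` (+) k ` {1..l}"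
      by (simp only: labels_def image_Un image_image label.map)
    moreover have "(+) k ` {1..l} = {k+1..k+l}" by simp
    ultimately show ?thesis by (simp only:)
  qed
  have "{1..k+l} = {1..k} \<union> {k+1..k+l}" by auto
  then show "labels (k + l) = labels k \<union> shift k ` labels l"
    unfolding img unfolding labels_def by (simp only: image_Un Un_ac)
  show "labels k \<inter> shift k ` labels l = {}"
    unfolding img unfolding labels_def by auto
qed

lemma partition_on_shift:
  "partition_on (labels l) Q \<Longrightarrow> partition_on (shift k ` labels l) ((`) (shift k) ` Q)"
  by (rule partition_on_image[OF _ inj_shift])

lemma inj_image_shift: "inj ((`) (shift k))"
  using inj_shift[of k UNIV] by (simp add: inj_image_eq_iff inj_def)

lemma card_Un_shift:
  assumes P: "partition_on (labels k) P" and Q: "partition_on (labels l) Q"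
  shows "card (P \<union> (`) (shift k) ` Q) = card P + card Q"
proof -
  have "card ((`) (shift k) ` Q) = card Q"
    by (rule card_image) (rule inj_on_subset[OF inj_image_shift subset_UNIV])
  then show ?thesis
    using card_partition_on_Un[OF P partition_on_shift[OF Q] labels_add_disjoint] by (simp add: finite_labels)
qed

lemma nc_tensor: "nc (p \<otimes>\<^sub>P q) = nc p + nc q"
  unfolding nc_def blocks_tensor by (rule card_Un_shift[OF partition_on_blocks partition_on_blocks])

text \<open>The labels split into a left part and a shifted right part, and joins are computed on
  each part separately.\<close>

lemma pjoin_tensor:
  assumes d: "deg p = deg p'" "deg q = deg q'"
  shows "pjoin (p \<otimes>\<^sub>P q) (p' \<otimes>\<^sub>P q') = pjoin p p' \<union> (`) (shift (deg p')) ` pjoin q q'"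
proof -
  have "is_join (labels (deg p') \<union> shift (deg p') ` labels (deg q'))
    (blocks p \<union> (`) (shift (deg p')) ` blocks q) (blocks p' \<union> (`) (shift (deg p')) ` blocks q')
    (pjoin p p' \<union> (`) (shift (deg p')) ` pjoin q q')"
    by (intro is_join_Un is_join_image inj_shift labels_add_disjoint is_join_pjoin d)
  then have "is_join (labels (deg (p' \<otimes>\<^sub>P q'))) (blocks (p \<otimes>\<^sub>P q)) (blocks (p' \<otimes>\<^sub>P q'))
    (pjoin p p' \<union> (`) (shift (deg p')) ` pjoin q q')"
    by (simp only: deg_tensor labels_add blocks_tensor d)
  moreover have "deg (p \<otimes>\<^sub>P q) = deg (p' \<otimes>\<^sub>P q')" using d by simp
  ultimately show ?thesis using is_join_unique is_join_pjoin by blast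
qed

lemma pdist_tensor:
  assumes d: "deg p = deg p'" "deg q = deg q'"
  shows "pdist (p \<otimes>\<^sub>P q) (p' \<otimes>\<^sub>P q') = pdist p p' + pdist q q'"
proof -
  have "partition_on (labels (deg p')) (pjoin p p')" "partition_on (labels (deg q')) (pjoin q q')"
    using refinesD(2)[OF is_joinD(1)[OF is_join_pjoin]] d by blast+
  then have "card (pjoin (p \<otimes>\<^sub>P q) (p' \<otimes>\<^sub>P q')) = card (pjoin p p') + card (pjoin q q')"
    unfolding pjoin_tensor[OF d] by (rule card_Un_shift)
  then show ?thesis by (simp add: pdist_pjoin nc_tensor field_simps)
qed

lemma id_diag_tensor: "id_diag k \<otimes>\<^sub>P id_diag l = id_diag (k + l)"
proof (rule pdiag_eqI)
  have img: "blocks (id_diag n) = (\<lambda>i. {Unprimed i, Primed i}) ` {1..n}" for n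
    by (auto simp: blocks_id_diag)
  have "{1..k+l} = {1..k} \<union> (+) k ` {1..l}" by auto
  then show "blocks (id_diag k \<otimes>\<^sub>P id_diag l) = blocks (id_diag (k + l))"
    by (simp only: blocks_tensor img deg_id_diag image_Un image_image image_insert image_empty label.map)
qed (simp add: deg_id_diag)

lemma ex_pdiag:
  assumes "partition_on (labels k) P"
  obtains p where "deg p = k" "blocks p = P"
  using assms that[of "Abs_pdiag (k, P)"] by (simp add: deg.rep_eq blocks.rep_eq Abs_pdiag_inverse)

text \<open>Each block of \<open>q\<close> lies in a block of \<open>X\<close> or of the shifted
  \<open>Y\<close>, hence on one side of the cut. The left blocks form \<open>q1\<close>; the right
  blocks, shifted back, form \<open>q2\<close>.\<close>

lemma split_pdiag:
  assumes ref: "refines (labels (k + l)) (blocks q) (X \<union> (`) (shift k) ` Y)"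
    and X: "partition_on (labels k) X" and Y: "partition_on (labels l) Y" and d: "deg q = k + l"
  obtains q1 q2 where "deg q1 = k" "deg q2 = l" "q = q1 \<otimes>\<^sub>P q2"
proof -
  let ?A = "labels k" and ?B = "shift k ` labels l" and ?g = "inv_into (labels l) (shift k)"
  have part: "partition_on (?A \<union> ?B) (blocks q)"
    using partition_on_blocks[of q] by (simp add: d labels_add)
  have split: "Z \<subseteq> ?A \<or> Z \<subseteq> ?B" if "Z \<in> blocks q" for Z
  proof -
    obtain W where "W \<in> X \<union> (`) (shift k) ` Y" "Z \<subseteq> W" using ref \<open>Z \<in> blocks q\<close> unfolding refines_def by meson
    then show ?thesis
      using partition_on_cover[OF X] partition_on_cover[OF partition_on_shift[OF Y]] by blast
  qed
  have A: "partition_on ?A {Z \<in> blocks q. Z \<subseteq> ?A}"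
    by (rule partition_on_split[OF part labels_add_disjoint split])
  have B: "partition_on ?B {Z \<in> blocks q. Z \<subseteq> ?B}"
  proof (rule partition_on_split[of _ ?A])
    show "partition_on (?B \<union> ?A) (blocks q)" using part by (simp only: Un_commute)
    show "?B \<inter> ?A = {}" using labels_add_disjoint[of k l] by (simp only: Int_commute)
  qed (use split in blast)
  obtain q1 where q1: "deg q1 = k" "blocks q1 = {Z \<in> blocks q. Z \<subseteq> ?A}"
    by (rule ex_pdiag[OF A])
  have "?g ` ?B = labels l" by (rule inv_into_image_cancel[OF inj_shift order_refl])
  then have "partition_on (labels l) ((`) ?g ` {Z \<in> blocks q. Z \<subseteq> ?B})"
    using partition_on_image[OF B inj_on_inv_into[OF order_refl]] by simp
  then obtain q2 where q2: "deg q2 = l" "blocks q2 = (`) ?g ` {Z \<in> blocks q. Z \<subseteq> ?B}"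
    by (rule ex_pdiag)
  have "shift k ` ?g ` Z = Z" if "Z \<in> {Z \<in> blocks q. Z \<subseteq> ?B}" for Z
    using that by (intro image_inv_into_cancel) auto
  then have "(\<lambda>Z. shift k ` ?g ` Z) ` {Z \<in> blocks q. Z \<subseteq> ?B} = (\<lambda>Z. Z) ` {Z \<in> blocks q. Z \<subseteq> ?B}"
    by (rule image_cong[OF refl])
  then have "(`) (shift k) ` blocks q2 = {Z \<in> blocks q. Z \<subseteq> ?B}"
    by (simp only: q2 image_image[of "(`) _"] image_ident)
  then have "blocks (q1 \<otimes>\<^sub>P q2) = {Z \<in> blocks q. Z \<subseteq> ?A} \<union> {Z \<in> blocks q. Z \<subseteq> ?B}"
    by (simp only: blocks_tensor q1)
  also have "\<dots> = blocks q" using split by blast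
  finally have "q = q1 \<otimes>\<^sub>P q2" using q1 q2 d by (intro pdiag_eqI) simp_all
  then show ?thesis using q1 q2 that by blast
qed

text \<open>The factors can be read off from the product once the cut is known: shifted blocks are
  nonempty and avoid \<open>labels (deg p)\<close>, so none of them is contained in it.\<close>

lemma blocks_tensor_left: "{Z \<in> blocks (p \<otimes>\<^sub>P q). Z \<subseteq> labels (deg p)} = blocks p" (is ?left)
  and blocks_tensor_right:
    "{Z \<in> blocks (p \<otimes>\<^sub>P q). \<not> Z \<subseteq> labels (deg p)} = (`) (shift (deg p)) ` blocks q" (is ?right)
proof -
  let ?Y = "(`) (shift (deg p)) ` blocks q"
  note S = partition_on_shift[OF partition_on_blocks[of q], of "deg p"]
  have "\<forall>Z\<in>?Y. \<not> Z \<subseteq> labels (deg p)"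
  proof
    fix Z assume Z: "Z \<in> ?Y"
    have "Z \<subseteq> shift (deg p) ` labels (deg q)" by (rule partition_on_cover[OF S Z])
    moreover have "Z \<noteq> {}" using partition_onD3[OF S] Z by metis
    ultimately show "\<not> Z \<subseteq> labels (deg p)" using labels_add_disjoint[of "deg p" "deg q"] by blast
  qed
  moreover have "\<forall>Z\<in>blocks p. Z \<subseteq> labels (deg p)"
    using partition_on_cover[OF partition_on_blocks[of p]] by blast
  ultimately show ?left ?right
    unfolding blocks_tensor by blast+
qed

text \<open>The degree hypothesis fixes the cut; without it
  \<open>id_diag 1 \<otimes>\<^sub>P id_diag 2\<close> and
  \<open>id_diag 2 \<otimes>\<^sub>P id_diag 1\<close> would be a counterexample.\<close>

lemma tensor_inject:
  assumes eq: "p \<otimes>\<^sub>P q = p' \<otimes>\<^sub>P q'" and d: "deg p = deg p'"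
  shows "p = p'" "q = q'"
proof -
  have "blocks p = blocks p'" using blocks_tensor_left[of p q] by (simp only: eq d blocks_tensor_left)
  then show "p = p'" by (rule pdiag_eqI[OF d])
  have "(`) (shift (deg p')) ` blocks q = (`) (shift (deg p')) ` blocks q'"
    using blocks_tensor_right[of p q] by (simp only: eq d blocks_tensor_right)
  then have "blocks q = blocks q'" by (simp only: inj_image_eq_iff[OF inj_image_shift])
  moreover have "deg q = deg q'" using arg_cong[OF eq, of deg] d by simp
  ultimately show "q = q'" by (intro pdiag_eqI)
qed

text \<open>Distances add under the tensor product. If the sum of the two triangle inequalities is
  an equality, then each of them is.\<close>

lemma geo_le_tensor_iff:
  assumes d: "deg q1 = deg p1" "deg q2 = deg p2"
  shows "q1 \<otimes>\<^sub>P q2 \<le>\<^sub>P p1 \<otimes>\<^sub>P p2 \<longleftrightarrow> q1 \<le>\<^sub>P p1 \<and> q2 \<le>\<^sub>P p2"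
proof -
  let ?i1 = "id_diag (deg p1)" and ?i2 = "id_diag (deg p2)"
  have d': "deg ?i1 = deg q1" "deg ?i2 = deg q2" "deg ?i1 = deg p1" "deg ?i2 = deg p2"
    using d by (simp_all add: deg_id_diag)
  have "pdist ?i1 p1 \<le> pdist ?i1 q1 + pdist q1 p1" "pdist ?i2 p2 \<le> pdist ?i2 q2 + pdist q2 p2"
    using d d' by (simp_all add: pdist_triangle)
  then show ?thesis
    using d d' by (auto simp: geo_le_def pdist_tensor simp flip: id_diag_tensor)
qed

text \<open>The point is that everything below the product splits: it refines the join of the
  identity with the product, which is itself a product, so \<open>split_pdiag\<close>
  applies.\<close>

lemma geo_le_tensor:
  "{q. q \<le>\<^sub>P p1 \<otimes>\<^sub>P p2} = (\<lambda>(q1, q2). q1 \<otimes>\<^sub>P q2) ` ({q. q \<le>\<^sub>P p1} \<times> {q. q \<le>\<^sub>P p2})"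
proof (intro equalityI subsetI)
  fix q assume "q \<in> {q. q \<le>\<^sub>P p1 \<otimes>\<^sub>P p2}"
  then have le: "q \<le>\<^sub>P p1 \<otimes>\<^sub>P p2" by simp
  let ?i1 = "id_diag (deg p1)" and ?i2 = "id_diag (deg p2)"
  have d: "deg ?i1 = deg p1" "deg ?i2 = deg p2" by (simp_all add: deg_id_diag)
  have parts: "partition_on (labels (deg p1)) (pjoin ?i1 p1)" "partition_on (labels (deg p2)) (pjoin ?i2 p2)"
    by (rule refinesD(2)[OF is_joinD(1)[OF is_join_pjoin]], rule d)+
  have "refines (labels (deg p1 + deg p2)) (blocks q)
      (pjoin ?i1 p1 \<union> (`) (shift (deg p1)) ` pjoin ?i2 p2)"
    using geo_le_refines[OF le] pjoin_tensor[OF d] by (simp add: id_diag_tensor)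
  then obtain q1 q2 where q: "deg q1 = deg p1" "deg q2 = deg p2" "q = q1 \<otimes>\<^sub>P q2"
    by (rule split_pdiag[OF _ parts]) (use geo_le_deg[OF le] in simp)
  then show "q \<in> (\<lambda>(q1, q2). q1 \<otimes>\<^sub>P q2) ` ({q. q \<le>\<^sub>P p1} \<times> {q. q \<le>\<^sub>P p2})"
    using le geo_le_tensor_iff[OF q(1,2)] by auto
next
  fix q assume "q \<in> (\<lambda>(q1, q2). q1 \<otimes>\<^sub>P q2) ` ({q. q \<le>\<^sub>P p1} \<times> {q. q \<le>\<^sub>P p2})"
  then obtain q1 q2 where "q = q1 \<otimes>\<^sub>P q2" "q1 \<le>\<^sub>P p1" "q2 \<le>\<^sub>P p2" by auto
  then show "q \<in> {q. q \<le>\<^sub>P p1 \<otimes>\<^sub>P p2}"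
    using geo_le_tensor_iff[OF geo_le_deg geo_le_deg] by simp
qed

lemma sum_geo_le_tensor:
  "(\<Sum>q | q \<le>\<^sub>P p1 \<otimes>\<^sub>P p2. f q) = (\<Sum>q1 | q1 \<le>\<^sub>P p1. \<Sum>q2 | q2 \<le>\<^sub>P p2. f (q1 \<otimes>\<^sub>P q2))"
proof -
  have "inj_on (\<lambda>(q1, q2). q1 \<otimes>\<^sub>P q2) ({q. q \<le>\<^sub>P p1} \<times> {q. q \<le>\<^sub>P p2})"
  proof (rule inj_onI, clarify)
    fix a b a' b' assume "a \<le>\<^sub>P p1" "a' \<le>\<^sub>P p1" and eq: "a \<otimes>\<^sub>P b = a' \<otimes>\<^sub>P b'"
    then have "deg a = deg a'" by (simp add: geo_le_deg)
    then show "a = a' \<and> b = b'" using tensor_inject[OF eq] by simp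
  qed
  then show ?thesis
    unfolding geo_le_tensor by (simp add: sum.reindex sum.cartesian_product case_prod_unfold)
qed

section \<open>Compatibility with the action of the symmetric groups\<close>

lemma inj_map_label: "\<sigma> permutes A \<Longrightarrow> inj_on (map_label \<sigma>) B"
  by (rule inj_on_subset[OF label.inj_map[OF permutes_inj] subset_UNIV])

lemma map_label_labels:
  assumes "\<sigma> permutes {1..k}"
  shows "map_label \<sigma> ` labels k = labels k"
proof -
  have "map_label \<sigma> ` labels k = Unprimed ` \<sigma> ` {1..k} \<union> Primed ` \<sigma> ` {1..k}"
    by (simp only: labels_def image_Un image_image label.map)
  then show ?thesis by (simp only: permutes_image[OF assms] labels_def)
qed

lemma inj_image_map_label: "\<sigma> permutes A \<Longrightarrow> inj ((`) (map_label \<sigma>))"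
  using inj_map_label[of \<sigma> A UNIV] by (simp add: inj_image_eq_iff inj_def)

lemma pdist_act:
  assumes \<sigma>: "\<sigma> permutes {1..deg p}" and d: "deg q = deg p"
  shows "pdist (act \<sigma> q) (act \<sigma> p) = pdist q p"
proof -
  have \<sigma>': "\<sigma> permutes {1..deg q}" using \<sigma> d by simp
  have card_img: "card ((`) (map_label \<sigma>) ` P) = card P" for P
    by (rule card_image) (rule inj_on_subset[OF inj_image_map_label[OF \<sigma>] subset_UNIV])
  have nc: "nc (act \<sigma> p) = nc p" "nc (act \<sigma> q) = nc q"
    by (simp_all only: nc_def blocks_act[OF \<sigma>] blocks_act[OF \<sigma>'] card_img)
  have "is_join (map_label \<sigma> ` labels (deg p)) ((`) (map_label \<sigma>) ` blocks q)
      ((`) (map_label \<sigma>) ` blocks p) ((`) (map_label \<sigma>) ` pjoin q p)"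
    by (rule is_join_image[OF is_join_pjoin[OF d] inj_map_label[OF \<sigma>]])
  then have "is_join (labels (deg (act \<sigma> p))) (blocks (act \<sigma> q)) (blocks (act \<sigma> p))
      ((`) (map_label \<sigma>) ` pjoin q p)"
    by (simp only: map_label_labels[OF \<sigma>] blocks_act[OF \<sigma>] blocks_act[OF \<sigma>'] deg_act[OF \<sigma>])
  moreover have "deg (act \<sigma> q) = deg (act \<sigma> p)" by (simp only: deg_act[OF \<sigma>] deg_act[OF \<sigma>'] d)
  ultimately have "pjoin (act \<sigma> q) (act \<sigma> p) = (`) (map_label \<sigma>) ` pjoin q p"
    using is_join_unique is_join_pjoin by blast
  then show ?thesis by (simp only: pdist_pjoin nc card_img)
qed

text \<open>Both rows are permuted alike, so the pair of labels at \<open>i\<close> goes to the pair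
  at \<open>\<sigma> i\<close>.\<close>

lemma act_id_diag:
  assumes "\<sigma> permutes {1..k}"
  shows "act \<sigma> (id_diag k) = id_diag k"
proof (rule pdiag_eqI)
  have \<sigma>: "\<sigma> permutes {1..deg (id_diag k)}" using assms by (simp add: deg_id_diag)
  show "deg (act \<sigma> (id_diag k)) = deg (id_diag k)" by (rule deg_act[OF \<sigma>])
  have img: "blocks (id_diag k) = (\<lambda>i. {Unprimed i, Primed i}) ` {1..k}"
    by (auto simp: blocks_id_diag)
  have "(\<lambda>i. {Unprimed (\<sigma> i), Primed (\<sigma> i)}) ` {1..k} = (\<lambda>i. {Unprimed i, Primed i}) ` \<sigma> ` {1..k}"
    by (simp only: image_image)
  then show "blocks (act \<sigma> (id_diag k)) = blocks (id_diag k)"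
    by (simp only: blocks_act[OF \<sigma>] img image_image image_insert image_empty label.map
        permutes_image[OF assms])
qed

text \<open>Relabelling preserves distances and fixes the identity, so it carries geodesics from the
  identity to geodesics from the identity.\<close>

lemma geo_le_act:
  assumes \<sigma>: "\<sigma> permutes {1..deg p}" and le: "q \<le>\<^sub>P p"
  shows "act \<sigma> q \<le>\<^sub>P act \<sigma> p"
proof -
  have d: "deg q = deg p" using le by (rule geo_le_deg)
  have \<sigma>': "\<sigma> permutes {1..deg q}" using \<sigma> d by simp
  have "pdist (id_diag (deg p)) (act \<sigma> r) = pdist (id_diag (deg p)) r" if "deg r = deg p" for r
    using pdist_act[of \<sigma> r "id_diag (deg p)"] \<sigma> that by (simp add: act_id_diag deg_id_diag)
  then show ?thesis
    using le d by (simp add: geo_le_def deg_act[OF \<sigma>] deg_act[OF \<sigma>'] pdist_act[OF \<sigma> d])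
qed

lemma act_act_inv:
  assumes \<sigma>: "\<sigma> permutes {1..deg p}"
  shows "act \<sigma> (act (inv \<sigma>) p) = p" "act (inv \<sigma>) (act \<sigma> p) = p"
proof -
  have *: "act \<tau> (act \<rho> p) = p"
    if \<rho>: "\<rho> permutes {1..deg p}" and \<tau>: "\<tau> permutes {1..deg p}" and id: "\<tau> \<circ> \<rho> = id" for \<tau> \<rho>
  proof -
    have \<tau>': "\<tau> permutes {1..deg (act \<rho> p)}" using \<tau> by (simp only: deg_act[OF \<rho>])
    show ?thesis
    proof (rule pdiag_eqI)
      have "map_label \<tau> (map_label \<rho> x) = x" for x
        by (simp only: label.map_comp id label.map_id)
      then show "blocks (act \<tau> (act \<rho> p)) = blocks p"
        by (simp only: blocks_act[OF \<rho>] blocks_act[OF \<tau>'] image_image image_ident)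
    qed (simp only: deg_act[OF \<rho>] deg_act[OF \<tau>'])
  qed
  have \<sigma>i: "inv \<sigma> permutes {1..deg p}" by (rule permutes_inv[OF \<sigma>])
  show "act \<sigma> (act (inv \<sigma>) p) = p" by (rule *[OF \<sigma>i \<sigma> permutes_inv_o(1)[OF \<sigma>]])
  show "act (inv \<sigma>) (act \<sigma> p) = p" by (rule *[OF \<sigma> \<sigma>i permutes_inv_o(2)[OF \<sigma>]])
qed

lemma sum_geo_le_act:
  assumes \<sigma>: "\<sigma> permutes {1..deg p}"
  shows "(\<Sum>q | q \<le>\<^sub>P act \<sigma> p. f q) = (\<Sum>q | q \<le>\<^sub>P p. f (act \<sigma> q))"
proof (rule sum.reindex_bij_witness[of _ "act \<sigma>" "act (inv \<sigma>)"])
  have \<sigma>i: "inv \<sigma> permutes {1..deg (act \<sigma> p)}" by (simp only: deg_act[OF \<sigma>] permutes_inv[OF \<sigma>])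
  fix q
  show "act \<sigma> (act (inv \<sigma>) q) = q" "act (inv \<sigma>) q \<in> {q. q \<le>\<^sub>P p}" "f (act \<sigma> (act (inv \<sigma>) q)) = f q"
    if "q \<in> {q. q \<le>\<^sub>P act \<sigma> p}"
  proof -
    have le: "q \<le>\<^sub>P act \<sigma> p" using that by simp
    have "\<sigma> permutes {1..deg q}" using geo_le_deg[OF le] \<sigma> by (simp only: deg_act[OF \<sigma>])
    then show *: "act \<sigma> (act (inv \<sigma>) q) = q" by (rule act_act_inv)
    then show "f (act \<sigma> (act (inv \<sigma>) q)) = f q" by simp
    show "act (inv \<sigma>) q \<in> {q. q \<le>\<^sub>P p}"
      using geo_le_act[OF \<sigma>i le] by (simp only: act_act_inv[OF \<sigma>] mem_Collect_eq)
  qed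
  show "act (inv \<sigma>) (act \<sigma> q) = q" "act \<sigma> q \<in> {q. q \<le>\<^sub>P act \<sigma> p}" if "q \<in> {q. q \<le>\<^sub>P p}"
  proof -
    have le: "q \<le>\<^sub>P p" using that by simp
    have "\<sigma> permutes {1..deg q}" using geo_le_deg[OF le] \<sigma> by simp
    then show "act (inv \<sigma>) (act \<sigma> q) = q" by (rule act_act_inv)
    show "act \<sigma> q \<in> {q. q \<le>\<^sub>P act \<sigma> p}" using geo_le_act[OF \<sigma> le] by simp
  qed
qed

section \<open>Inversion of the transform\<close>

lemma sum_geo_le_split: "(\<Sum>q | q \<le>\<^sub>P p. f q) = f p + (\<Sum>q | q \<le>\<^sub>P p \<and> q \<noteq> p. f q)"
  for f :: "pdiag \<Rightarrow> 'a::comm_monoid_add"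
proof -
  have "{q. q \<le>\<^sub>P p} = insert p {q. q \<le>\<^sub>P p \<and> q \<noteq> p}" using geo_le_refl by auto
  moreover have "finite {q. q \<le>\<^sub>P p \<and> q \<noteq> p}" using finite_geo_le[of p] by simp
  ultimately show ?thesis by simp
qed

text \<open>The uniqueness half of Moebius inversion: by induction on the rank all terms strictly
  below \<open>p\<close> vanish, which leaves \<open>f p\<close> alone in the sum.\<close>

lemma sum_geo_le_eq_0:
  fixes f :: "pdiag \<Rightarrow> 'a::comm_monoid_add"
  assumes "\<And>p. (\<Sum>q | q \<le>\<^sub>P p. f q) = 0"
  shows "f p = 0"
proof (induction p rule: measure_induct_rule[of geo_rank])
  case (less p)
  have "(\<Sum>q | q \<le>\<^sub>P p \<and> q \<noteq> p. f q) = 0"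
    by (rule sum.neutral) (simp add: less geo_rank_less)
  then show ?case using assms[of p] sum_geo_le_split[of f p] by simp
qed

text \<open>The existence half of Moebius inversion: the recursion solves the order-sum equation for
  its top term.\<close>

function mobius :: "(pdiag \<Rightarrow> complex) \<Rightarrow> pdiag \<Rightarrow> complex" where
  "mobius g p = g p - (\<Sum>q \<in> {q. q \<le>\<^sub>P p \<and> q \<noteq> p}. mobius g q)"
  by auto
termination
  by (relation "measure (\<lambda>(g, p). geo_rank p)") (auto simp: geo_rank_less)

declare mobius.simps [simp del]

lemma sum_mobius: "(\<Sum>q | q \<le>\<^sub>P p. mobius g q) = g p"
  using sum_geo_le_split[of "mobius g" p] mobius.simps[of g p] by simp

section \<open>Linear forms through their values on the basis, and bijectivity of the
  transform\<close>

definition linear_extension :: "(pdiag \<Rightarrow> complex) \<Rightarrow> pspace \<Rightarrow> complex" where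
  "linear_extension f x = (\<Sum>p \<in> Poly_Mapping.keys x. Poly_Mapping.lookup x p * f p)"

lemma linear_extension_basis [simp]: "linear_extension f \<langle>p\<rangle> = f p"
  by (simp add: linear_extension_def)

lemma linear_extension_linear: "linear_extension f \<in> linear_forms"
proof -
  \<comment> \<open>The order sums of \<open>mobius f\<close> give back \<open>f\<close>, so
    linearity is inherited from \<open>M_transform_linear\<close>.\<close>
  have "linear_extension f = M_transform (linear_extension (mobius f))"
    by (rule ext) (simp add: M_transform_def sum_mobius linear_extension_def[of f])
  then show ?thesis using M_transform_linear by metis
qed

lemma linear_forms_eqI:
  assumes \<phi>: "\<phi> \<in> linear_forms" and \<psi>: "\<psi> \<in> linear_forms" and eq: "\<And>p. \<phi> \<langle>p\<rangle> = \<psi> \<langle>p\<rangle>"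
  shows "\<phi> = \<psi>"
proof
  fix x
  have hom: "module_hom cscale (*) \<chi>" if "\<chi> \<in> linear_forms" for \<chi>
    using that by (simp add: linear_forms_def Vector_Spaces.linear_iff_module_hom)
  have x: "x = (\<Sum>p\<in>Poly_Mapping.keys x. cscale (Poly_Mapping.lookup x p) \<langle>p\<rangle>)"
    by (rule poly_mapping_eqI)
      (auto simp: lookup_sum lookup_cscale lookup_single when_def in_keys_iff
        if_distrib[of "\<lambda>y. _ * y"] sum.delta cong: if_cong)
  show "\<phi> x = \<psi> x"
    using module_hom.sum[OF hom[OF \<phi>], of "\<lambda>p. cscale (Poly_Mapping.lookup x p) \<langle>p\<rangle>" "Poly_Mapping.keys x"]
      module_hom.sum[OF hom[OF \<psi>], of "\<lambda>p. cscale (Poly_Mapping.lookup x p) \<langle>p\<rangle>" "Poly_Mapping.keys x"]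
    unfolding x[symmetric]
    by (simp only: module_hom.scale[OF hom[OF \<phi>]] module_hom.scale[OF hom[OF \<psi>]] eq)
qed

lemma bij_betw_M_transform: "bij_betw M_transform linear_forms linear_forms"
  unfolding bij_betw_def
proof
  show "inj_on M_transform linear_forms"
  proof (rule inj_onI)
    fix \<phi> \<psi> assume \<phi>: "\<phi> \<in> linear_forms" and \<psi>: "\<psi> \<in> linear_forms" and eq: "M_transform \<phi> = M_transform \<psi>"
    have "(\<Sum>q | q \<le>\<^sub>P p. \<phi> \<langle>q\<rangle> - \<psi> \<langle>q\<rangle>) = 0" for p
      using fun_cong[OF eq, of "\<langle>p\<rangle>"] by (simp add: M_transform_basis sum_subtractf)
    then have "\<phi> \<langle>p\<rangle> - \<psi> \<langle>p\<rangle> = 0" for p by (rule sum_geo_le_eq_0)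
    then show "\<phi> = \<psi>" by (intro linear_forms_eqI \<phi> \<psi>) simp
  qed
  show "M_transform ` linear_forms = linear_forms"
  proof (intro equalityI subsetI)
    fix \<psi> assume \<psi>: "\<psi> \<in> linear_forms"
    have "\<psi> = M_transform (linear_extension (mobius (\<lambda>p. \<psi> \<langle>p\<rangle>)))"
      by (rule linear_forms_eqI[OF \<psi> M_transform_linear]) (simp add: M_transform_basis sum_mobius)
    then show "\<psi> \<in> M_transform ` linear_forms" using linear_extension_linear by (rule image_eqI)
  qed (auto intro: M_transform_linear)
qed

section \<open>Transforms of characters\<close>

text \<open>One direction reindexes the order sum along the action; the other applies
  \<open>sum_geo_le_eq_0\<close> to the defect of invariance.\<close>

lemma M_transform_invariant_iff:
  assumes \<phi>: "\<phi> \<in> linear_forms"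
  shows "M_transform \<phi> \<in> invariant_forms \<longleftrightarrow> \<phi> \<in> invariant_forms"
proof
  assume "\<phi> \<in> invariant_forms"
  then have inv: "\<phi> \<langle>act \<sigma> p\<rangle> = \<phi> \<langle>p\<rangle>" if "\<sigma> permutes {1..deg p}" for \<sigma> p
    using that by (simp add: invariant_forms_def)
  have "M_transform \<phi> \<langle>act \<sigma> p\<rangle> = M_transform \<phi> \<langle>p\<rangle>" if \<sigma>: "\<sigma> permutes {1..deg p}" for \<sigma> p
    unfolding M_transform_basis sum_geo_le_act[OF \<sigma>]
    by (rule sum.cong[OF refl]) (use \<sigma> geo_le_deg in \<open>auto intro!: inv\<close>)
  then show "M_transform \<phi> \<in> invariant_forms" by (simp add: invariant_forms_def M_transform_linear)
next
  assume "M_transform \<phi> \<in> invariant_forms"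
  then have inv: "M_transform \<phi> \<langle>act \<sigma> p\<rangle> = M_transform \<phi> \<langle>p\<rangle>" if "\<sigma> permutes {1..deg p}" for \<sigma> p
    using that by (simp add: invariant_forms_def)
  have "\<phi> \<langle>act \<sigma> p\<rangle> = \<phi> \<langle>p\<rangle>" if \<sigma>: "\<sigma> permutes {1..deg p}" for \<sigma> p
  proof -
    \<comment> \<open>The action of \<open>\<sigma>\<close> is meaningful only in degree
      \<open>deg p\<close>, so the defect is set to 0 elsewhere. Since the order preserves the
      degree, every order sum lies entirely in one of the two cases.\<close>
    define f where "f q = (if deg q = deg p then \<phi> \<langle>act \<sigma> q\<rangle> - \<phi> \<langle>q\<rangle> else 0)" for q
    have "(\<Sum>q | q \<le>\<^sub>P r. f q) = 0" for r
    proof (cases "deg r = deg p")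
      case True
      then have \<sigma>r: "\<sigma> permutes {1..deg r}" using \<sigma> by simp
      have "(\<Sum>q | q \<le>\<^sub>P r. f q) = (\<Sum>q | q \<le>\<^sub>P r. \<phi> \<langle>act \<sigma> q\<rangle> - \<phi> \<langle>q\<rangle>)"
        by (rule sum.cong[OF refl]) (simp add: f_def geo_le_deg True)
      also have "\<dots> = 0"
        using inv[OF \<sigma>r] by (simp add: M_transform_basis sum_subtractf sum_geo_le_act[OF \<sigma>r])
      finally show ?thesis .
    next
      case False
      then show ?thesis by (intro sum.neutral) (simp add: f_def geo_le_deg)
    qed
    then have "f p = 0" by (rule sum_geo_le_eq_0)
    then show ?thesis by (simp add: f_def)
  qed
  then show "\<phi> \<in> invariant_forms" using \<phi> by (simp add: invariant_forms_def)
qed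

text \<open>By \<open>sum_geo_le_tensor\<close>, the defect of the character equation for \<open>M_transform \<phi>\<close>, with \<open>\<epsilon>\<close>
  replaced by its own sum over the order, is the double sum of the defect for \<open>\<phi>\<close>.\<close>

lemma M_transform_inf_char_iff:
  "(\<forall>p q. M_transform \<phi> \<langle>p \<otimes>\<^sub>P q\<rangle>
      = M_transform \<phi> \<langle>p\<rangle> * (\<Sum>r | r \<le>\<^sub>P q. \<epsilon> r) + (\<Sum>r | r \<le>\<^sub>P p. \<epsilon> r) * M_transform \<phi> \<langle>q\<rangle>)
    \<longleftrightarrow> (\<forall>p q. \<phi> \<langle>p \<otimes>\<^sub>P q\<rangle> = \<phi> \<langle>p\<rangle> * \<epsilon> q + \<epsilon> p * \<phi> \<langle>q\<rangle>)"
proof -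
  define F where "F p q = \<phi> \<langle>p \<otimes>\<^sub>P q\<rangle> - (\<phi> \<langle>p\<rangle> * \<epsilon> q + \<epsilon> p * \<phi> \<langle>q\<rangle>)" for p q
  have sum_F: "(\<Sum>p' | p' \<le>\<^sub>P p. \<Sum>q' | q' \<le>\<^sub>P q. F p' q') = M_transform \<phi> \<langle>p \<otimes>\<^sub>P q\<rangle>
    - (M_transform \<phi> \<langle>p\<rangle> * (\<Sum>r | r \<le>\<^sub>P q. \<epsilon> r) + (\<Sum>r | r \<le>\<^sub>P p. \<epsilon> r) * M_transform \<phi> \<langle>q\<rangle>)" for p q
    by (simp add: F_def M_transform_basis sum_geo_le_tensor sum_subtractf sum.distrib sum_product)
  have "F p q = 0" if "\<And>p q. (\<Sum>p' | p' \<le>\<^sub>P p. \<Sum>q' | q' \<le>\<^sub>P q. F p' q') = 0" for p q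
  proof -
    \<comment> \<open>Uniqueness is applied twice: here to the outer variable with \<open>q\<close>
      fixed, then to the inner one.\<close>
    have "(\<Sum>q' | q' \<le>\<^sub>P q. F p q') = 0" for p q
      using that by (rule sum_geo_le_eq_0)
    then show ?thesis by (rule sum_geo_le_eq_0)
  qed
  then have "(\<forall>p q. (\<Sum>p' | p' \<le>\<^sub>P p. \<Sum>q' | q' \<le>\<^sub>P q. F p' q') = 0) \<longleftrightarrow> (\<forall>p q. F p q = 0)"
    by (metis (no_types, lifting) sum.neutral)
  then show ?thesis unfolding sum_F unfolding F_def by simp
qed

text \<open>The order preserves the degree and there is only one partition of degree 0, so no
  \<open>q\<close> strictly below \<open>p\<close> can be \<open>id_diag 0\<close>.\<close>

lemma sum_eps_plus: "(\<Sum>q | q \<le>\<^sub>P p. eps_plus q) = eps_plus p"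
proof -
  have "eps_plus q = 0" if "q \<le>\<^sub>P p" "q \<noteq> p" for q
    using geo_le_deg[OF that(1)] that(2) by (metis deg_0_iff eps_plus_def)
  then show ?thesis by (simp add: sum_geo_le_split)
qed

text \<open>The identity lies below every partition of its degree and alone carries weight
  there.\<close>

lemma sum_eps_times: "(\<Sum>q | q \<le>\<^sub>P p. eps_times q) = 1"
proof -
  have "(\<Sum>q | q \<le>\<^sub>P p. eps_times q) = (\<Sum>q | q \<le>\<^sub>P p. if q = id_diag (deg p) then 1 else 0)"
    by (rule sum.cong[OF refl]) (simp add: eps_times_def geo_le_deg)
  also have "\<dots> = 1" using finite_geo_le[of p] id_diag_geo_le[of p] by (simp add: sum.delta)
  finally show ?thesis .
qed

lemma M_transform_inf_chars_plus_iff: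
  "\<phi> \<in> linear_forms \<Longrightarrow> M_transform \<phi> \<in> inf_chars eps_plus \<longleftrightarrow> \<phi> \<in> inf_chars eps_plus"
  using M_transform_inf_char_iff[of \<phi> eps_plus]
  by (simp add: inf_chars_def M_transform_invariant_iff sum_eps_plus)

lemma M_transform_additive_chars_iff:
  "\<phi> \<in> linear_forms \<Longrightarrow> M_transform \<phi> \<in> additive_chars \<longleftrightarrow> \<phi> \<in> inf_chars eps_times"
  using M_transform_inf_char_iff[of \<phi> eps_times]
  by (simp add: inf_chars_def additive_chars_def M_transform_invariant_iff sum_eps_times)

text \<open>The equivalence on all of \<open>A\<close> makes \<open>B'\<close> exactly the image of
  \<open>B\<close>. The inverse is taken on \<open>A\<close>, not on \<open>B\<close>, to match the
  definition of \<open>R_transform\<close>.\<close>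

lemma bij_betw_subset_iff:
  assumes f: "bij_betw f A A'" and "B \<subseteq> A" "B' \<subseteq> A'" and iff: "\<And>x. x \<in> A \<Longrightarrow> f x \<in> B' \<longleftrightarrow> x \<in> B"
  shows "bij_betw f B B'" "bij_betw (inv_into A f) B' B"
proof -
  have "f ` B = B'"
  proof (intro equalityI subsetI)
    fix y assume "y \<in> B'"
    then obtain x where "x \<in> A" "y = f x" using f \<open>B' \<subseteq> A'\<close> by (auto simp: bij_betw_def)
    then show "y \<in> f ` B" using iff \<open>y \<in> B'\<close> by blast
  qed (use iff \<open>B \<subseteq> A\<close> in blast)
  then show "bij_betw f B B'" "bij_betw (inv_into A f) B' B"
    using bij_betw_subset[OF f \<open>B \<subseteq> A\<close>] bij_betw_inv_into_subset[OF f \<open>B \<subseteq> A\<close>] by auto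
qed

theorem theorem4p2:
  shows "bij_betw M_transform (inf_chars eps_plus) (inf_chars eps_plus)
    \<and> bij_betw M_transform (inf_chars eps_times) additive_chars
    \<and> bij_betw R_transform (inf_chars eps_plus) (inf_chars eps_plus)
    \<and> bij_betw R_transform additive_chars (inf_chars eps_times)"
proof -
  have sub: "inf_chars \<epsilon> \<subseteq> linear_forms" "additive_chars \<subseteq> linear_forms" for \<epsilon>
    by (auto simp: inf_chars_def additive_chars_def invariant_forms_def)
  show ?thesis
    unfolding R_transform_def
    by (intro conjI bij_betw_subset_iff[OF bij_betw_M_transform sub(1) sub(1) M_transform_inf_chars_plus_iff]
        bij_betw_subset_iff[OF bij_betw_M_transform sub(1) sub(2) M_transform_additive_chars_iff])
qed

end
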